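(* Fix $\theta\in(-\frac{\pi}{2},\frac{\pi}{2})$. The semigroup $\{T_t^2\}_{t\ge0}$ defined below is a semigroup of normal operators in $L^2(\gamma)$, and consequently its infinitesimal generator $\mathcal{A}_2$ is a normal operator in $L^2(\gamma)$.
   Context: Identify $\mathbb{R}^2$ with $\mathbb{C}$ via $(y_1,y_2)\mapsto y_1+\mathrm{i}y_2$. Let $d\gamma(y)=\frac{1}{2\pi}e^{-(y_1^2+y_2^2)/2}\,dy_1\,dy_2$ and $L^p(\gamma)$ the corresponding complex $L^p$ spaces. For $\varphi\in C_b(\mathbb{R}^2)$ (bounded continuous complex functions), $t\ge0$, $x\in\mathbb{C}$, let $$P_t\varphi(x)=\int_{\mathbb{C}}\varphi\big(e^{-(\cos\theta+\mathrm{i}\sin\theta)t}x+\sqrt{1-e^{-2t\cos\theta}}\,y\big)\,d\gamma(y).$$ For each $p\ge1$, $\|P_t\varphi\|_{L^p(\gamma)}\le\|\varphi\|_{L^p(\gamma)}$, and $\{P_t\}$ extends uniquely (by closure) to a strongly continuous contraction semigroup $\{T_t^p\}_{t\ge0}$ on $L^p(\gamma)$; $\mathcal{A}_p$ denotes its infinitesimal generator. An (unbounded, densely defined, closed) operator $N$ is normal if $D(N)=D(N^* )$ and $\|Nf\|=\|N^*f\|$ for $f\in D(N)$ (equivalently $NN^*=N^*N$). *)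

theory Defs
  imports "HOL-Analysis.Analysis"
begin

definition gauss :: "complex measure" where
  "gauss = density lborel (\<lambda>z. ennreal (exp (- ((cmod z)^2) / 2) / (2 * pi)))"

text \<open>Square integrable (representatives of elements of) L^2(gamma).\<close>
definition L2 :: "(complex \<Rightarrow> complex) \<Rightarrow> bool" where
  "L2 f \<longleftrightarrow> f \<in> borel_measurable gauss \<and> integrable gauss (\<lambda>x. (cmod (f x))^2)"

definition L2norm :: "(complex \<Rightarrow> complex) \<Rightarrow> real" where
  "L2norm f = sqrt (integral\<^sup>L gauss (\<lambda>x. (cmod (f x))^2))"

definition L2inner :: "(complex \<Rightarrow> complex) \<Rightarrow> (complex \<Rightarrow> complex) \<Rightarrow> complex" where
  "L2inner f g = integral\<^sup>L gauss (\<lambda>x. f x * cnj (g x))"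

definition Cb :: "(complex \<Rightarrow> complex) \<Rightarrow> bool" where
  "Cb \<phi> \<longleftrightarrow> continuous_on UNIV \<phi> \<and> bounded (range \<phi>)"

definition Pt :: "real \<Rightarrow> real \<Rightarrow> (complex \<Rightarrow> complex) \<Rightarrow> complex \<Rightarrow> complex" where
  "Pt \<theta> t \<phi> x = integral\<^sup>L gauss (\<lambda>y. \<phi> (exp (- cis \<theta> * complex_of_real t) * x
        + complex_of_real (sqrt (1 - exp (-2 * t * cos \<theta>))) * y))"

text \<open>The closure of P_t in L^2: g represents T_t f iff there are bounded continuous
  phi_n with phi_n \<rightarrow> f and P_t phi_n \<rightarrow> g in L^2(gamma).\<close>
definition Trel :: "real \<Rightarrow> real \<Rightarrow> (complex \<Rightarrow> complex) \<Rightarrow> (complex \<Rightarrow> complex) \<Rightarrow> bool" where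
  "Trel \<theta> t f g \<longleftrightarrow> (\<exists>\<phi> :: nat \<Rightarrow> complex \<Rightarrow> complex. (\<forall>n. Cb (\<phi> n)) \<and>
      (\<lambda>n. L2norm (\<lambda>x. \<phi> n x - f x)) \<longlonglongrightarrow> 0 \<and>
      (\<lambda>n. L2norm (\<lambda>x. Pt \<theta> t (\<phi> n) x - g x)) \<longlonglongrightarrow> 0)"

definition T2 :: "real \<Rightarrow> real \<Rightarrow> (complex \<Rightarrow> complex) \<Rightarrow> complex \<Rightarrow> complex" where
  "T2 \<theta> t f = (SOME g. L2 g \<and> Trel \<theta> t f g)"

definition gen_lim :: "real \<Rightarrow> (complex \<Rightarrow> complex) \<Rightarrow> (complex \<Rightarrow> complex) \<Rightarrow> bool" where
  "gen_lim \<theta> f h \<longleftrightarrow> L2 h \<and>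
     ((\<lambda>s. L2norm (\<lambda>x. (T2 \<theta> s f x - f x) / complex_of_real s - h x)) \<longlongrightarrow> 0) (at_right 0)"

definition gen_dom :: "real \<Rightarrow> (complex \<Rightarrow> complex) set" where
  "gen_dom \<theta> = {f. L2 f \<and> (\<exists>h. gen_lim \<theta> f h)}"

definition gen :: "real \<Rightarrow> (complex \<Rightarrow> complex) \<Rightarrow> complex \<Rightarrow> complex" where
  "gen \<theta> f = (SOME h. gen_lim \<theta> f h)"

definition adj_dom :: "(complex \<Rightarrow> complex) set \<Rightarrow> ((complex \<Rightarrow> complex) \<Rightarrow> complex \<Rightarrow> complex)
    \<Rightarrow> (complex \<Rightarrow> complex) set" where
  "adj_dom D N = {g. L2 g \<and> (\<exists>h. L2 h \<and> (\<forall>f\<in>D. L2inner (N f) g = L2inner f h))}"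

definition adj :: "(complex \<Rightarrow> complex) set \<Rightarrow> ((complex \<Rightarrow> complex) \<Rightarrow> complex \<Rightarrow> complex)
    \<Rightarrow> (complex \<Rightarrow> complex) \<Rightarrow> complex \<Rightarrow> complex" where
  "adj D N g = (SOME h. L2 h \<and> (\<forall>f\<in>D. L2inner (N f) g = L2inner f h))"

definition normal_op :: "(complex \<Rightarrow> complex) set \<Rightarrow> ((complex \<Rightarrow> complex) \<Rightarrow> complex \<Rightarrow> complex) \<Rightarrow> bool" where
  "normal_op D N \<longleftrightarrow>
     D \<subseteq> {f. L2 f} \<and> (\<forall>f\<in>D. L2 (N f)) \<and>
     (\<forall>f. L2 f \<longrightarrow> (\<forall>e>0. \<exists>g\<in>D. L2norm (\<lambda>x. f x - g x) < e)) \<and>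
     (\<forall>fs f h. (\<forall>n. fs n \<in> D) \<and> L2 f \<and> L2 h \<and>
         (\<lambda>n. L2norm (\<lambda>x. fs n x - f x)) \<longlonglongrightarrow> 0 \<and>
         (\<lambda>n. L2norm (\<lambda>x. N (fs n) x - h x)) \<longlonglongrightarrow> 0
       \<longrightarrow> f \<in> D \<and> L2norm (\<lambda>x. N f x - h x) = 0) \<and>
     adj_dom D N = D \<and>
     (\<forall>f\<in>D. L2norm (N f) = L2norm (adj D N f))"

end

theory Submission
  imports Defs "HOL-Probability.Distributions"
begin

text \<open>
  Write \<open>M a f x = \<integral> f (a x + s y) d\<gamma>(y)\<close> with \<open>s = sqrt (1 - |a|\<^sup>2)\<close>, so that
  \<open>P\<^sub>t = M (exp (- t e\<^sup>i\<^sup>\<theta>))\<close>. The map \<open>(x, y) \<mapsto> (a x + s y, s x - cnj a y)\<close> is unitary and hence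
  preserves \<open>\<gamma> \<otimes> \<gamma>\<close>. Therefore \<open>M a\<close> is a contraction of \<open>L\<^sup>2(\<gamma>)\<close> with adjoint \<open>M (cnj a)\<close>, and
  \<open>M a M b = M (a b)\<close>; in particular every \<open>M a\<close> is normal and all of them commute.

  Let \<open>S\<close> be the adjoint semigroup of a contraction semigroup \<open>T\<close> on a Hilbert space. The generator of
  \<open>T\<close> sends \<open>x\<close> to \<open>h\<close> iff \<open>T t x - x = \<integral>\<^sub>0\<^sup>t T s h ds\<close> for all \<open>t\<close>, so that its adjoint is the
  generator of \<open>S\<close>. If \<open>T\<close> and \<open>S\<close> commute, the operator \<open>(T s - I)/s - (T r - I)/r\<close> is normal, so the
  difference quotients of \<open>T\<close> and \<open>S\<close> at a vector converge simultaneously, to limits of equal norm.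
\<close>

section \<open>Limits and one-sided derivatives\<close>

lemma has_vector_derivative_at_right_iff:
  fixes f :: "real \<Rightarrow> 'a::real_normed_vector"
  shows "(f has_vector_derivative D) (at a within {a..}) \<longleftrightarrow>
    ((\<lambda>s. (f (a + s) - f a) /\<^sub>R s) \<longlongrightarrow> D) (at_right 0)"
proof -
  have "(1 / norm (x - a)) *\<^sub>R (f x - (f a + (x - a) *\<^sub>R D)) = (f x - f a) /\<^sub>R (x - a) - D"
    if "x > a" for x
    using that by (simp add: scaleR_diff_right scaleR_add_right inverse_eq_divide)
  then have "\<forall>\<^sub>F x in at_right a.
      (1 / norm (x - a)) *\<^sub>R (f x - (f a + (x - a) *\<^sub>R D)) = (f x - f a) /\<^sub>R (x - a) - D"
    using eventually_at_right_less[of a] by (auto elim: eventually_mono)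
  then have "(f has_vector_derivative D) (at a within {a..}) \<longleftrightarrow>
      ((\<lambda>x. (f x - f a) /\<^sub>R (x - a) - D) \<longlongrightarrow> 0) (at_right a)"
    unfolding has_vector_derivative_def has_derivative_within at_within_Ici_at_right
    by (auto simp: bounded_linear_scaleR_left cong: filterlim_cong)
  then show ?thesis
    by (simp add: LIM_zero_iff filterlim_at_right_to_0[of _ _ a] add.commute)
qed

lemma tendsto_if_equidistant:
  fixes f :: "'i \<Rightarrow> 'a::metric_space" and g :: "'i \<Rightarrow> 'b::complete_space"
  assumes "(f \<longlongrightarrow> l) F" "eventually P F"
    and equidistant: "\<And>i j. P i \<Longrightarrow> P j \<Longrightarrow> dist (g i) (g j) = dist (f i) (f j)"
  obtains m where "(g \<longlongrightarrow> m) F"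
proof -
  have "cauchy_filter (filtermap f F)"
    using assms(1) unfolding filterlim_def by (rule nhds_imp_cauchy_filter)
  have "cauchy_filter (filtermap g F)"
    unfolding cauchy_filter_metric_filtermap
  proof (intro allI impI)
    fix e :: real assume "e > 0"
    with \<open>cauchy_filter (filtermap f F)\<close> obtain Q
      where "eventually Q F" "\<And>i j. Q i \<Longrightarrow> Q j \<Longrightarrow> dist (f i) (f j) < e"
      unfolding cauchy_filter_metric_filtermap by metis
    with assms(2) show "\<exists>Q. eventually Q F \<and> (\<forall>i j. Q i \<and> Q j \<longrightarrow> dist (g i) (g j) < e)"
      by (intro exI[of _ "\<lambda>i. P i \<and> Q i"]) (auto simp: eventually_conj equidistant)
  qed
  then have "convergent_filter (filtermap g F)"
    by (rule cauchy_filter_convergent)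
  then show thesis
    using that by (auto simp: convergent_filter_iff filterlim_def)
qed

lemma tendsto_nonexpansive_if_dense:
  fixes T :: "'i \<Rightarrow> 'a::metric_space \<Rightarrow> 'b::metric_space"
  assumes dense: "closure D = UNIV"
    and T: "\<And>i x y. dist (T i x) (T i y) \<le> dist x y" and L: "\<And>x y. dist (L x) (L y) \<le> dist x y"
    and lim: "\<And>d. d \<in> D \<Longrightarrow> ((\<lambda>i. T i d) \<longlongrightarrow> L d) F"
  shows "((\<lambda>i. T i x) \<longlongrightarrow> L x) F"
proof (rule tendstoI)
  fix e :: real assume "e > 0"
  have "x \<in> closure D" by (simp add: dense)
  then obtain d where d: "d \<in> D" "dist d x < e / 3"
    using \<open>e > 0\<close> unfolding closure_approachable by (meson divide_pos_pos zero_less_numeral)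
  have "\<forall>\<^sub>F i in F. dist (T i d) (L d) < e / 3"
    using tendstoD[OF lim[OF d(1)], of "e / 3"] \<open>e > 0\<close> by simp
  then show "\<forall>\<^sub>F i in F. dist (T i x) (L x) < e"
  proof eventually_elim
    case (elim i)
    have "dist (T i x) (L x) \<le> dist (T i x) (T i d) + dist (T i d) (L d) + dist (L d) (L x)"
      by metric
    also have "\<dots> < e / 3 + e / 3 + e / 3"
      using T[of i x d] L[of d x] elim d(2) by (simp add: dist_commute)
    finally show ?case by simp
  qed
qed

section \<open>Contraction semigroups on Banach spaces\<close>

locale contraction_semigroup =
  fixes T :: "real \<Rightarrow> 'a::banach \<Rightarrow> 'a"
  assumes linear: "t \<ge> 0 \<Longrightarrow> linear (T t)"
    and contraction: "t \<ge> 0 \<Longrightarrow> norm (T t x) \<le> norm x"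
    and zero: "T 0 x = x"
    and add: "s \<ge> 0 \<Longrightarrow> t \<ge> 0 \<Longrightarrow> T (s + t) x = T s (T t x)"
    and continuous_orbit: "continuous_on {0..} (\<lambda>t. T t x)"
begin

lemma bounded_linear: "t \<ge> 0 \<Longrightarrow> bounded_linear (T t)"
  using linear contraction
  by (auto simp: bounded_linear_def bounded_linear_axioms_def intro!: exI[of _ 1])

lemma orbit_integrable: "0 \<le> a \<Longrightarrow> (\<lambda>s. T s x) integrable_on {a..b}"
  by (rule integrable_continuous_interval, rule continuous_on_subset[OF continuous_orbit]) auto

definition generator_maps :: "'a \<Rightarrow> 'a \<Rightarrow> bool" where
  "generator_maps x h \<longleftrightarrow> ((\<lambda>t. T t x) has_vector_derivative h) (at 0 within {0..})"

definition generator_dom :: "'a set" where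
  "generator_dom = {x. \<exists>h. generator_maps x h}"

definition generator :: "'a \<Rightarrow> 'a" where
  "generator x = (THE h. generator_maps x h)"

definition orbit_integral :: "real \<Rightarrow> 'a \<Rightarrow> 'a" where
  "orbit_integral t x = integral {0..t} (\<lambda>s. T s x)"

lemma generator_maps_iff_tendsto:
  "generator_maps x h \<longleftrightarrow> ((\<lambda>s. (T s x - x) /\<^sub>R s) \<longlongrightarrow> h) (at_right 0)"
  by (simp add: generator_maps_def has_vector_derivative_at_right_iff zero)

lemma generator_maps_unique: "generator_maps x h \<Longrightarrow> generator_maps x k \<Longrightarrow> h = k"
  unfolding generator_maps_iff_tendsto by (rule tendsto_unique[rotated]) auto

lemma generator_maps_iff: "generator_maps x h \<longleftrightarrow> x \<in> generator_dom \<and> generator x = h"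
  unfolding generator_dom_def generator_def using generator_maps_unique
  by (auto intro: theI the_equality)

lemma generator_maps_bounded_linear:
  assumes "bounded_linear L" and commute: "\<And>t x. t \<ge> 0 \<Longrightarrow> T t (L x) = L (T t x)"
    and "generator_maps x h"
  shows "generator_maps (L x) (L h)"
proof -
  have "((\<lambda>t. L (T t x)) has_vector_derivative L h) (at 0 within {0..})"
    using assms(1,3) unfolding generator_maps_def by (rule bounded_linear.has_vector_derivative)
  then show ?thesis
    unfolding generator_maps_def by (rule has_vector_derivative_weaken) (auto simp: commute)
qed

lemma bounded_linear_orbit_integral:
  assumes "t \<ge> 0"
  shows "bounded_linear (orbit_integral t)"
proof (rule bounded_linear_intro)
  fix x y and r :: real
  have "orbit_integral t (x + y) = integral {0..t} (\<lambda>s. T s x + T s y)"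
    unfolding orbit_integral_def by (intro integral_cong) (simp add: linear_add[OF linear])
  then show "orbit_integral t (x + y) = orbit_integral t x + orbit_integral t y"
    by (simp add: orbit_integral_def integral_add orbit_integrable)
  have "orbit_integral t (r *\<^sub>R x) = integral {0..t} (\<lambda>s. r *\<^sub>R T s x)"
    unfolding orbit_integral_def by (intro integral_cong) (simp add: linear_scale[OF linear])
  then show "orbit_integral t (r *\<^sub>R x) = r *\<^sub>R orbit_integral t x"
    by (simp add: orbit_integral_def)
  have "norm (orbit_integral t x) \<le> norm x * (t - 0)"
    unfolding orbit_integral_def
    by (rule integral_bound[OF assms])
       (auto intro: contraction continuous_on_subset[OF continuous_orbit])
  then show "norm (orbit_integral t x) \<le> norm x * t"
    by simp
qed

lemma orbit_integral_T:
  assumes "r \<ge> 0"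
  shows "T r (orbit_integral t x) = orbit_integral t (T r x)"
proof -
  have "T r (orbit_integral t x) = integral {0..t} (\<lambda>s. T r (T s x))"
    using integral_linear[OF orbit_integrable bounded_linear[OF assms]]
    by (simp add: orbit_integral_def o_def)
  also have "\<dots> = orbit_integral t (T r x)"
    unfolding orbit_integral_def
    using assms by (intro integral_cong) (simp add: add.commute flip: add)
  finally show ?thesis .
qed

lemma orbit_integral_add:
  assumes "r \<ge> 0" "t \<ge> 0"
  shows "orbit_integral (r + t) x = orbit_integral r x + T r (orbit_integral t x)"
proof -
  have "orbit_integral (r + t) x = orbit_integral r x + integral {r..r + t} (\<lambda>s. T s x)"
    unfolding orbit_integral_def using assms orbit_integrable
    by (intro Henstock_Kurzweil_Integration.integral_combine[symmetric]) auto
  also have "integral {r..r + t} (\<lambda>s. T s x) = integral {0..t} (\<lambda>s. T (s + r) x)"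
    using integral_shift_Icc_real[of 0 t "\<lambda>s. T s x" r] by (simp add: o_def add.commute)
  also have "\<dots> = orbit_integral t (T r x)"
    unfolding orbit_integral_def using assms by (intro integral_cong) (simp add: add)
  finally show ?thesis
    by (simp add: orbit_integral_T[OF assms(1)])
qed

lemma has_vector_derivative_orbit_integral:
  "((\<lambda>t. orbit_integral t x) has_vector_derivative x) (at 0 within {0..})"
proof -
  have "((\<lambda>t. orbit_integral t x) has_vector_derivative T 0 x) (at 0 within {0..1})"
    unfolding orbit_integral_def
    by (rule integral_has_vector_derivative) (auto intro: continuous_on_subset[OF continuous_orbit])
  then show ?thesis
    by (simp add: zero at_within_Icc_at_right at_within_Ici_at_right)
qed

lemma generator_maps_orbit_integral:
  assumes "t \<ge> 0"
  shows "generator_maps (orbit_integral t x) (T t x - x)"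
  unfolding generator_maps_def
proof (rule has_vector_derivative_weaken)
  show "((\<lambda>r. orbit_integral t x + (T t (orbit_integral r x) - orbit_integral r x))
      has_vector_derivative T t x - x) (at 0 within {0..})"
    by (rule has_vector_derivative_add[OF has_vector_derivative_const, unfolded add_0])
       (intro has_vector_derivative_diff has_vector_derivative_orbit_integral
        bounded_linear.has_vector_derivative[OF bounded_linear[OF assms]])
  show "orbit_integral t x + (T t (orbit_integral r x) - orbit_integral r x) =
      T r (orbit_integral t x)" if "r \<in> {0..}" for r
    using orbit_integral_add[of r t x] orbit_integral_add[of t r x] assms that
    by (simp add: algebra_simps)
qed simp_all

lemma generator_maps_iff_orbit_integral:
  "generator_maps x h \<longleftrightarrow> (\<forall>t\<ge>0. T t x - x = orbit_integral t h)"
proof (intro iffI allI impI)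
  fix t :: real
  assume "generator_maps x h" "t \<ge> 0"
  then have "generator_maps (orbit_integral t x) (orbit_integral t h)"
    using generator_maps_bounded_linear bounded_linear_orbit_integral orbit_integral_T by metis
  with generator_maps_orbit_integral[OF \<open>t \<ge> 0\<close>] show "T t x - x = orbit_integral t h"
    by (rule generator_maps_unique)
next
  assume eq: "\<forall>t\<ge>0. T t x - x = orbit_integral t h"
  show "generator_maps x h"
    unfolding generator_maps_def
  proof (rule has_vector_derivative_weaken)
    show "((\<lambda>t. x + orbit_integral t h) has_vector_derivative h) (at 0 within {0..})"
      by (rule has_vector_derivative_add[OF has_vector_derivative_const, unfolded add_0])
         (rule has_vector_derivative_orbit_integral)
    show "x + orbit_integral t h = T t x" if "t \<in> {0..}" for t
      using that by (simp flip: eq[rule_format])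
  qed simp_all
qed

lemma closed_generator: "closed {(x, h). generator_maps x h}"
proof -
  have "closed {p. T t (fst p) - fst p = orbit_integral t (snd p)}" if "t \<ge> 0" for t
    by (intro closed_Collect_eq continuous_intros
        bounded_linear.continuous_on[OF bounded_linear[OF that]]
        bounded_linear.continuous_on[OF bounded_linear_orbit_integral[OF that]])
  then have "closed (\<Inter>t\<in>{0..}. {p. T t (fst p) - fst p = orbit_integral t (snd p)})"
    by auto
  then show ?thesis
    by (rule back_subst[of closed]) (auto simp: generator_maps_iff_orbit_integral)
qed

lemma generator_dom_dense: "closure generator_dom = UNIV"
proof -
  have "x \<in> closure generator_dom" for x
  proof (rule Lim_in_closed_set)
    show "((\<lambda>t. orbit_integral t x /\<^sub>R t) \<longlongrightarrow> x) (at_right 0)"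
      using has_vector_derivative_orbit_integral[of x]
      by (simp add: has_vector_derivative_at_right_iff orbit_integral_def)
    have "orbit_integral t x /\<^sub>R t \<in> generator_dom" if "t > 0" for t
      using that generator_maps_bounded_linear[OF bounded_linear_scaleR_right _
          generator_maps_orbit_integral[of t x], of "inverse t"]
      by (auto simp: generator_dom_def linear_scale[OF linear])
    then show "\<forall>\<^sub>F t in at_right 0. orbit_integral t x /\<^sub>R t \<in> closure generator_dom"
      using eventually_at_right_less[of "0::real"] closure_subset by (fastforce elim: eventually_mono)
  qed auto
  then show ?thesis by auto
qed

end

section \<open>Normal operators and normal semigroups\<close>

definition adjoint_maps :: "'a::real_inner set \<Rightarrow> ('a \<Rightarrow> 'a) \<Rightarrow> 'a \<Rightarrow> 'a \<Rightarrow> bool" where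
  "adjoint_maps D A y k \<longleftrightarrow> (\<forall>x\<in>D. inner (A x) y = inner x k)"

definition normal_operator :: "'a::real_inner set \<Rightarrow> ('a \<Rightarrow> 'a) \<Rightarrow> bool" where
  "normal_operator D A \<longleftrightarrow>
     closure D = UNIV \<and>
     closed {(x, y). x \<in> D \<and> A x = y} \<and>
     (\<forall>y. y \<in> D \<longleftrightarrow> (\<exists>k. adjoint_maps D A y k)) \<and>
     (\<forall>y\<in>D. \<forall>k. adjoint_maps D A y k \<longrightarrow> norm k = norm (A y))"

lemma norm_eq_of_commuting_adjoint:
  fixes X Y :: "'a::real_inner \<Rightarrow> 'a"
  assumes adjoint: "\<And>x y. inner (X x) y = inner x (Y y)"
    and commute: "\<And>x. X (Y x) = Y (X x)"
  shows "norm (X x) = norm (Y x)"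
proof -
  have "inner (X x) (X x) = inner x (X (Y x))"
    by (simp add: adjoint commute)
  also have "\<dots> = inner (Y x) (Y x)"
    by (metis adjoint inner_commute)
  finally show ?thesis
    by (simp add: norm_eq_sqrt_inner)
qed

locale adjoint_semigroups = T: contraction_semigroup T + S: contraction_semigroup S
  for T S :: "real \<Rightarrow> 'a::{real_inner,banach} \<Rightarrow> 'a" +
  assumes adjoint: "t \<ge> 0 \<Longrightarrow> inner (T t x) y = inner x (S t y)"
begin

lemma inner_generator_maps:
  assumes "T.generator_maps x h" "S.generator_maps y k"
  shows "inner h y = inner x k"
proof (rule tendsto_unique)
  show "((\<lambda>s. inner ((T s x - x) /\<^sub>R s) y) \<longlongrightarrow> inner h y) (at_right 0)"
    using assms(1) unfolding T.generator_maps_iff_tendsto by (intro tendsto_intros)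
  have "((\<lambda>s. inner x ((S s y - y) /\<^sub>R s)) \<longlongrightarrow> inner x k) (at_right 0)"
    using assms(2) unfolding S.generator_maps_iff_tendsto by (intro tendsto_intros)
  moreover have "\<forall>\<^sub>F s in at_right 0. inner x ((S s y - y) /\<^sub>R s) = inner ((T s x - x) /\<^sub>R s) y"
    using eventually_at_right_less by eventually_elim (simp add: inner_diff adjoint)
  ultimately show "((\<lambda>s. inner ((T s x - x) /\<^sub>R s) y) \<longlongrightarrow> inner x k) (at_right 0)"
    by (rule Lim_transform_eventually)
qed simp

lemma inner_orbit_integral: "inner (T.orbit_integral t x) y = inner x (S.orbit_integral t y)"
proof -
  have "inner (T.orbit_integral t x) y = integral {0..t} (\<lambda>s. inner (T s x) y)"
    using integral_linear[OF T.orbit_integrable bounded_linear_inner_left, of 0]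
    by (simp add: T.orbit_integral_def o_def)
  also have "\<dots> = integral {0..t} (\<lambda>s. inner x (S s y))"
    by (intro integral_cong) (simp add: adjoint)
  also have "\<dots> = inner x (S.orbit_integral t y)"
    using integral_linear[OF S.orbit_integrable bounded_linear_inner_right, of 0]
    by (simp add: S.orbit_integral_def o_def)
  finally show ?thesis .
qed

theorem adjoint_generator:
  "adjoint_maps T.generator_dom T.generator y k \<longleftrightarrow> S.generator_maps y k"
proof
  assume "S.generator_maps y k"
  then show "adjoint_maps T.generator_dom T.generator y k"
    using inner_generator_maps by (auto simp: adjoint_maps_def T.generator_maps_iff)
next
  assume adj: "adjoint_maps T.generator_dom T.generator y k"
  have "S t y - y = S.orbit_integral t k" if "t \<ge> 0" for t
  proof -
    have "inner x (S t y - y) = inner x (S.orbit_integral t k)" for x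
    proof -
      have "inner x (S t y - y) = inner (T t x - x) y"
        using that by (simp add: adjoint inner_diff)
      also have "\<dots> = inner (T.orbit_integral t x) k"
        using adj T.generator_maps_orbit_integral[OF that, of x]
        unfolding adjoint_maps_def T.generator_maps_iff by metis
      also have "\<dots> = inner x (S.orbit_integral t k)"
        by (rule inner_orbit_integral)
      finally show ?thesis .
    qed
    then show ?thesis
      by (metis vector_eq_ldot)
  qed
  then show "S.generator_maps y k"
    by (simp add: S.generator_maps_iff_orbit_integral)
qed

end

locale normal_semigroup = adjoint_semigroups +
  assumes commute: "s \<ge> 0 \<Longrightarrow> t \<ge> 0 \<Longrightarrow> T s (S t x) = S t (T s x)"
begin

lemma swap: "normal_semigroup S T"
proof unfold_locales
  show "inner (S t x) y = inner x (T t y)" if "t \<ge> 0" for t x y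
    using adjoint[OF that, of y x] by (simp add: inner_commute)
qed (simp add: commute)

lemma norm_T_eq_norm_S: "t \<ge> 0 \<Longrightarrow> norm (T t x) = norm (S t x)"
  by (rule norm_eq_of_commuting_adjoint) (auto simp: adjoint commute)

theorem normal_operator_T:
  assumes "t \<ge> 0"
  shows "normal_operator UNIV (T t)"
proof -
  have adj: "adjoint_maps UNIV (T t) y k \<longleftrightarrow> S t y = k" for y k
    unfolding adjoint_maps_def adjoint[OF assms] by (simp add: vector_eq_ldot)
  have "closed {p. T t (fst p) = snd p}"
    by (intro closed_Collect_eq continuous_intros
        bounded_linear.continuous_on[OF T.bounded_linear[OF assms]])
  then show ?thesis
    using norm_T_eq_norm_S[OF assms] by (simp add: normal_operator_def adj case_prod_beta')
qed

lemma norm_difference_quotients: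
  assumes "s \<ge> 0" "r \<ge> 0"
  shows "norm ((T s x - x) /\<^sub>R s - (T r x - x) /\<^sub>R r) = norm ((S s x - x) /\<^sub>R s - (S r x - x) /\<^sub>R r)"
  by (rule norm_eq_of_commuting_adjoint[where X = "\<lambda>x. (T s x - x) /\<^sub>R s - (T r x - x) /\<^sub>R r"
        and Y = "\<lambda>x. (S s x - x) /\<^sub>R s - (S r x - x) /\<^sub>R r"])
     (use assms in \<open>simp_all add: adjoint commute linear_add[OF T.linear] linear_add[OF S.linear]
        linear_diff[OF T.linear] linear_diff[OF S.linear] linear_scale[OF T.linear]
        linear_scale[OF S.linear] algebra_simps\<close>)

lemma generator_maps_norm_eq:
  assumes "T.generator_maps x h"
  obtains k where "S.generator_maps x k" "norm k = norm h"
proof -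
  let ?dT = "\<lambda>s. (T s x - x) /\<^sub>R s" and ?dS = "\<lambda>s. (S s x - x) /\<^sub>R s"
  have dT: "(?dT \<longlongrightarrow> h) (at_right 0)"
    using assms by (simp add: T.generator_maps_iff_tendsto)
  have equidistant: "dist (?dS s) (?dS r) = dist (?dT s) (?dT r)" if "s > 0" "r > 0" for s r
    using norm_difference_quotients[of s r x] that by (simp add: dist_norm)
  obtain k where dS: "(?dS \<longlongrightarrow> k) (at_right 0)"
    using tendsto_if_equidistant[OF dT eventually_at_right_less, of ?dS] equidistant by blast
  have "norm (?dT s) = norm (?dS s)" if "s > 0" for s
    \<comment> \<open>At \<open>r = 0\<close> the second quotient is \<open>0\<close>, as \<open>inverse 0 = 0\<close>.\<close>
    using norm_difference_quotients[of s 0 x] that by simp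
  then have "\<forall>\<^sub>F s in at_right 0. norm (?dT s) = norm (?dS s)"
    using eventually_at_right_less[of "0::real"] by (auto elim: eventually_mono)
  with tendsto_norm[OF dT] have "((\<lambda>s. norm (?dS s)) \<longlongrightarrow> norm h) (at_right 0)"
    by (rule Lim_transform_eventually)
  with tendsto_norm[OF dS] have "norm k = norm h"
    by (rule tendsto_unique[OF trivial_limit_at_right_real])
  with dS that show thesis
    by (simp add: S.generator_maps_iff_tendsto)
qed

theorem normal_operator_generator: "normal_operator T.generator_dom T.generator"
proof -
  interpret swap: normal_semigroup S T by (rule swap)
  have S_imp_T: "norm k = norm (T.generator y)" "y \<in> T.generator_dom"
    if "S.generator_maps y k" for y k
    using swap.generator_maps_norm_eq[OF that] T.generator_maps_iff by metis+
  moreover have "\<exists>k. S.generator_maps y k" if "y \<in> T.generator_dom" for y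
    using that generator_maps_norm_eq unfolding T.generator_dom_def by blast
  ultimately show ?thesis
    using T.generator_dom_dense T.closed_generator
    by (auto simp: normal_operator_def adjoint_generator T.generator_maps_iff)
qed

end

section \<open>Square integrable functions\<close>

definition square_integrable ::
    "'a measure \<Rightarrow> ('a \<Rightarrow> 'b::{banach, second_countable_topology}) \<Rightarrow> bool" where
  "square_integrable M f \<longleftrightarrow> f \<in> borel_measurable M \<and> integrable M (\<lambda>x. (norm (f x))\<^sup>2)"

definition mean_square ::
    "'a measure \<Rightarrow> ('a \<Rightarrow> 'b::{banach, second_countable_topology}) \<Rightarrow> real" where
  "mean_square M f = (\<integral>x. (norm (f x))\<^sup>2 \<partial>M)"

definition mean_square_Cauchy ::
    "'a measure \<Rightarrow> (nat \<Rightarrow> 'a \<Rightarrow> 'b::{banach, second_countable_topology}) \<Rightarrow> bool" where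
  "mean_square_Cauchy M F \<longleftrightarrow>
    (\<forall>e>0. \<exists>N. \<forall>m\<ge>N. \<forall>n\<ge>N. mean_square M (\<lambda>x. F m x - F n x) < e)"

lemma square_integrable_measurable [measurable_dest]:
  "square_integrable M f \<Longrightarrow> f \<in> borel_measurable M"
  by (simp add: square_integrable_def)

lemma square_integrable_norm_square:
  "square_integrable M f \<Longrightarrow> integrable M (\<lambda>x. (norm (f x))\<^sup>2)"
  by (simp add: square_integrable_def)

lemma mean_square_nonneg: "0 \<le> mean_square M f"
  by (simp add: mean_square_def)

lemma nn_integral_norm_square:
  "square_integrable M f \<Longrightarrow> (\<integral>\<^sup>+x. ennreal ((norm (f x))\<^sup>2) \<partial>M) = ennreal (mean_square M f)"
  unfolding mean_square_def by (intro nn_integral_eq_integral square_integrable_norm_square) auto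

lemma square_integrable_bound:
  assumes "f \<in> borel_measurable M" "integrable M w" "AE x in M. (norm (f x))\<^sup>2 \<le> w x"
  shows "square_integrable M f"
  unfolding square_integrable_def
proof
  show "integrable M (\<lambda>x. (norm (f x))\<^sup>2)"
    using assms(2) by (rule Bochner_Integration.integrable_bound) (use assms in auto)
qed fact

lemma square_integrable_bounded_linear:
  assumes "bounded_linear L" and f: "square_integrable M f"
  shows "square_integrable M (\<lambda>x. L (f x))"
proof -
  obtain K where K: "\<And>y. norm (L y) \<le> norm y * K"
    using bounded_linear.bounded[OF assms(1)] by blast
  show ?thesis
  proof (rule square_integrable_bound)
    show "(\<lambda>x. L (f x)) \<in> borel_measurable M"
      using linear_continuous_on[OF assms(1)] square_integrable_measurable[OF f]
      by (rule borel_measurable_continuous_on)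
    show "integrable M (\<lambda>x. K\<^sup>2 * (norm (f x))\<^sup>2)"
      using f by (intro integrable_mult_right square_integrable_norm_square)
    have "(norm (L y))\<^sup>2 \<le> (norm y * K)\<^sup>2" for y
      using K by (rule power_mono) simp
    then show "AE x in M. (norm (L (f x)))\<^sup>2 \<le> K\<^sup>2 * (norm (f x))\<^sup>2"
      by (simp add: power_mult_distrib mult.commute)
  qed
qed

lemma norm_add_square_le:
  fixes x y :: "'a::real_normed_vector"
  shows "(norm (x + y))\<^sup>2 \<le> 2 * (norm x)\<^sup>2 + 2 * (norm y)\<^sup>2"
proof -
  have "(norm (x + y))\<^sup>2 \<le> (norm x + norm y)\<^sup>2"
    by (intro power_mono norm_triangle_ineq) auto
  also have "\<dots> \<le> 2 * (norm x)\<^sup>2 + 2 * (norm y)\<^sup>2"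
    using sum_squares_bound[of "norm x" "norm y"] by (simp add: power2_sum)
  finally show ?thesis .
qed

lemma
  assumes f [measurable]: "square_integrable M f" and g [measurable]: "square_integrable M g"
  shows square_integrable_add: "square_integrable M (\<lambda>x. f x + g x)"
    and mean_square_add_le:
      "mean_square M (\<lambda>x. f x + g x) \<le> 2 * mean_square M f + 2 * mean_square M g"
proof -
  note integrable = square_integrable_norm_square[OF f] square_integrable_norm_square[OF g]
  have bound: "integrable M (\<lambda>x. 2 * (norm (f x))\<^sup>2 + 2 * (norm (g x))\<^sup>2)"
    using integrable by auto
  show "square_integrable M (\<lambda>x. f x + g x)"
    by (rule square_integrable_bound[OF _ bound]) (auto simp: norm_add_square_le)
  then have "(\<integral>x. (norm (f x + g x))\<^sup>2 \<partial>M) \<le> (\<integral>x. 2 * (norm (f x))\<^sup>2 + 2 * (norm (g x))\<^sup>2 \<partial>M)"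
    by (intro integral_mono square_integrable_norm_square bound norm_add_square_le)
  also have "\<dots> = 2 * (\<integral>x. (norm (f x))\<^sup>2 \<partial>M) + 2 * (\<integral>x. (norm (g x))\<^sup>2 \<partial>M)"
    using integrable by simp
  finally show "mean_square M (\<lambda>x. f x + g x) \<le> 2 * mean_square M f + 2 * mean_square M g"
    by (simp add: mean_square_def)
qed

lemma square_integrable_uminus: "square_integrable M f \<Longrightarrow> square_integrable M (\<lambda>x. - f x)"
  by (rule square_integrable_bounded_linear[OF bounded_linear_minus[OF bounded_linear_ident]])

lemma square_integrable_diff:
  "square_integrable M f \<Longrightarrow> square_integrable M g \<Longrightarrow> square_integrable M (\<lambda>x. f x - g x)"
  using square_integrable_add[OF _ square_integrable_uminus] by fastforce

lemma square_integrable_norm_mult: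
  assumes f [measurable]: "square_integrable M f" and g [measurable]: "square_integrable M g"
  shows "integrable M (\<lambda>x. norm (f x) * norm (g x))"
proof (rule Bochner_Integration.integrable_bound)
  show "(\<lambda>x. norm (f x) * norm (g x)) \<in> borel_measurable M"
    by measurable
  show "integrable M (\<lambda>x. (norm (f x))\<^sup>2 + (norm (g x))\<^sup>2)"
    using f g by (intro Bochner_Integration.integrable_add square_integrable_norm_square)
  have "norm (f x) * norm (g x) \<le> (norm (f x))\<^sup>2 + (norm (g x))\<^sup>2" for x
    using sum_squares_bound[of "norm (f x)" "norm (g x)"]
      mult_nonneg_nonneg[OF norm_ge_zero norm_ge_zero, of "f x" "g x"] by linarith
  then show "AE x in M. norm (norm (f x) * norm (g x)) \<le> norm ((norm (f x))\<^sup>2 + (norm (g x))\<^sup>2)"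
    by simp
qed

lemma Cauchy_Schwarz_integral:
  assumes f [measurable]: "square_integrable M f" and g [measurable]: "square_integrable M g"
  shows "(\<integral>x. norm (f x) * norm (g x) \<partial>M)\<^sup>2 \<le> mean_square M f * mean_square M g"
proof -
  have product: "(\<integral>\<^sup>+x. ennreal (norm (f x)) * ennreal (norm (g x)) \<partial>M) =
      ennreal (\<integral>x. norm (f x) * norm (g x) \<partial>M)"
    using nn_integral_eq_integral[OF square_integrable_norm_mult[OF f g]] by (simp add: ennreal_mult)
  have "ennreal ((\<integral>x. norm (f x) * norm (g x) \<partial>M)\<^sup>2) \<le> ennreal (mean_square M f * mean_square M g)"
    using Cauchy_Schwarz_nn_integral[of "\<lambda>x. ennreal (norm (f x))" M "\<lambda>x. ennreal (norm (g x))"]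
    by (simp add: product f g nn_integral_norm_square ennreal_power ennreal_mult mean_square_nonneg)
  then show ?thesis
    by (simp add: mean_square_nonneg ennreal_le_iff)
qed

lemma Fatou_mean_square:
  assumes F [measurable]: "\<And>n. square_integrable M (F n)" and [measurable]: "f \<in> borel_measurable M"
    and lim: "AE x in M. (\<lambda>n. F n x) \<longlonglongrightarrow> f x"
    and bound: "\<And>n. n \<ge> N \<Longrightarrow> mean_square M (F n) \<le> B"
  shows "square_integrable M f" "mean_square M f \<le> B"
proof -
  have B: "0 \<le> B"
    using mean_square_nonneg bound[of N] by (rule order_trans) simp
  have "(\<integral>\<^sup>+x. ennreal ((norm (f x))\<^sup>2) \<partial>M) = (\<integral>\<^sup>+x. liminf (\<lambda>n. ennreal ((norm (F n x))\<^sup>2)) \<partial>M)"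
  proof (rule nn_integral_cong_AE, use lim in eventually_elim)
    case (elim x)
    then have "(\<lambda>n. ennreal ((norm (F n x))\<^sup>2)) \<longlonglongrightarrow> ennreal ((norm (f x))\<^sup>2)"
      by (intro tendsto_intros tendsto_ennrealI)
    from lim_imp_Liminf[OF _ this] show ?case by simp
  qed
  also have "\<dots> \<le> liminf (\<lambda>n. \<integral>\<^sup>+x. ennreal ((norm (F n x))\<^sup>2) \<partial>M)"
    by (rule nn_integral_liminf) measurable
  also have "\<dots> = liminf (\<lambda>n. ennreal (mean_square M (F n)))"
    by (simp add: nn_integral_norm_square F)
  also have "\<dots> \<le> liminf (\<lambda>n. ennreal B)"
    using bound by (intro Liminf_mono eventually_sequentiallyI[of N] ennreal_leI)
  finally have le: "(\<integral>\<^sup>+x. ennreal ((norm (f x))\<^sup>2) \<partial>M) \<le> ennreal B"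
    by (simp add: Liminf_const)
  then have "integrable M (\<lambda>x. (norm (f x))\<^sup>2)"
    by (intro integrableI_nonneg) (auto simp: less_top[symmetric] top_unique)
  with le show "square_integrable M f" "mean_square M f \<le> B"
    using B
    by (simp_all add: square_integrable_def mean_square_def nn_integral_eq_integral ennreal_le_iff)
qed

lemma mean_square_Cauchy_tendsto:
  assumes F [measurable]: "\<And>n. square_integrable M (F n)" and Cauchy: "mean_square_Cauchy M F"
    and r: "strict_mono r" and [measurable]: "f \<in> borel_measurable M"
    and lim: "AE x in M. (\<lambda>k. F (r k) x) \<longlonglongrightarrow> f x"
  shows "square_integrable M f" "(\<lambda>n. mean_square M (\<lambda>x. F n x - f x)) \<longlonglongrightarrow> 0"
proof -
  have near: "\<exists>N. \<forall>n\<ge>N. square_integrable M (\<lambda>x. F n x - f x) \<and> mean_square M (\<lambda>x. F n x - f x) \<le> e"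
    if "e > 0" for e
  proof -
    obtain N where N: "\<And>m n. m \<ge> N \<Longrightarrow> n \<ge> N \<Longrightarrow> mean_square M (\<lambda>x. F m x - F n x) < e"
      using Cauchy \<open>e > 0\<close> unfolding mean_square_Cauchy_def by meson
    have "square_integrable M (\<lambda>x. F n x - f x)" "mean_square M (\<lambda>x. F n x - f x) \<le> e" if "n \<ge> N" for n
    proof -
      have "AE x in M. (\<lambda>k. F n x - F (r k) x) \<longlonglongrightarrow> F n x - f x"
        using lim by eventually_elim (intro tendsto_intros)
      moreover have "mean_square M (\<lambda>x. F n x - F (r k) x) \<le> e" if "k \<ge> N" for k
        using N[OF \<open>n \<ge> N\<close>, of "r k"] seq_suble[OF r, of k] that by simp
      ultimately show "square_integrable M (\<lambda>x. F n x - f x)" "mean_square M (\<lambda>x. F n x - f x) \<le> e"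
        using Fatou_mean_square[of M "\<lambda>k x. F n x - F (r k) x" "\<lambda>x. F n x - f x" N e]
          square_integrable_diff[OF F F] by auto
    qed
    then show ?thesis by blast
  qed
  obtain n where "square_integrable M (\<lambda>x. F n x - f x)"
    using near[of 1] by auto
  then show "square_integrable M f"
    using square_integrable_diff[OF F[of n]] by force
  show "(\<lambda>n. mean_square M (\<lambda>x. F n x - f x)) \<longlonglongrightarrow> 0"
  proof (rule LIMSEQ_I)
    fix e :: real assume "e > 0"
    with near[of "e / 2"] show "\<exists>N. \<forall>n\<ge>N. norm (mean_square M (\<lambda>x. F n x - f x) - 0) < e"
      by (fastforce simp: mean_square_nonneg)
  qed
qed

lemma tendsto_mean_square_dominated:
  fixes f :: "'a \<Rightarrow> 'b::{banach, second_countable_topology}"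
  assumes [measurable]: "\<And>n. F n \<in> borel_measurable M" "f \<in> borel_measurable M"
    and lim: "\<And>x. x \<in> space M \<Longrightarrow> (\<lambda>n. F n x) \<longlonglongrightarrow> f x"
    and bound: "\<And>n x. norm (F n x) \<le> w x"
    and w: "integrable M (\<lambda>x. (w x)\<^sup>2)"
  shows "(\<lambda>n. mean_square M (\<lambda>x. F n x - f x)) \<longlonglongrightarrow> 0"
proof -
  have "(\<lambda>n. \<integral>x. (norm (F n x - f x))\<^sup>2 \<partial>M) \<longlonglongrightarrow> (\<integral>x. 0 \<partial>M)"
  proof (rule integral_dominated_convergence)
    show "integrable M (\<lambda>x. 4 * (w x)\<^sup>2)"
      using w by simp
    show "AE x in M. (\<lambda>n. (norm (F n x - f x))\<^sup>2) \<longlonglongrightarrow> 0"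
      using lim by (intro AE_I2) (auto intro!: tendsto_eq_intros)
    show "AE x in M. norm ((norm (F n x - f x))\<^sup>2) \<le> 4 * (w x)\<^sup>2" for n
    proof (rule AE_I2)
      fix x assume "x \<in> space M"
      then have "norm (f x) \<le> w x"
        by (intro LIMSEQ_le_const2[OF tendsto_norm[OF lim]]) (auto simp: bound)
      then have "norm (F n x - f x) \<le> 2 * w x"
        using norm_triangle_ineq4[of "F n x" "f x"] bound[of n x] by simp
      then have "(norm (F n x - f x))\<^sup>2 \<le> (2 * w x)\<^sup>2"
        by (intro power_mono) auto
      then show "norm ((norm (F n x - f x))\<^sup>2) \<le> 4 * (w x)\<^sup>2"
        by (simp add: power_mult_distrib)
    qed
  qed measurable
  then show ?thesis
    by (simp add: mean_square_def)
qed

lemma borel_measurable_cnj [measurable (raw)]: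
  "f \<in> borel_measurable M \<Longrightarrow> (\<lambda>x. cnj (f x)) \<in> borel_measurable M"
  by (rule borel_measurable_continuous_on) (auto intro: continuous_intros)

lemma integrable_mult_cnj:
  assumes [measurable]: "square_integrable M f" "square_integrable M g"
  shows "integrable M (\<lambda>x. f x * cnj (g x))"
  by (rule Bochner_Integration.integrable_bound[OF square_integrable_norm_mult[OF assms]])
     (auto simp: norm_mult)

context finite_measure
begin

lemma square_integrable_bounded:
  assumes "f \<in> borel_measurable M" "\<And>x. x \<in> space M \<Longrightarrow> norm (f x) \<le> B"
  shows "square_integrable M f"
  by (rule square_integrable_bound[OF assms(1), of "\<lambda>_. B\<^sup>2"]) (auto intro!: power_mono assms)

lemma square_integrable_const: "square_integrable M (\<lambda>_. c)"
  by (rule square_integrable_bounded[of _ "norm c"]) auto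

lemma integrable_if_square_integrable:
  assumes "square_integrable M f"
  shows "integrable M f"
  using square_integrable_norm_mult[OF assms square_integrable_const[of "1::real"]]
    square_integrable_measurable[OF assms] by (simp add: integrable_norm_iff)

lemma integral_norm_square_le:
  assumes "square_integrable M f"
  shows "(\<integral>x. norm (f x) \<partial>M)\<^sup>2 \<le> measure M (space M) * mean_square M f"
  using Cauchy_Schwarz_integral[OF assms square_integrable_const[of "1::real"]]
  by (simp add: mean_square_def mult.commute)

lemma mean_square_Cauchy_AE_Cauchy_subseq:
  assumes F [measurable]: "\<And>n. square_integrable M (F n)" and Cauchy: "mean_square_Cauchy M F"
  obtains r where "strict_mono r" "AE x in M. Cauchy (\<lambda>k. F (r k) x)"
proof -
  have "\<exists>N. \<forall>m\<ge>N. \<forall>n\<ge>N. (\<integral>x. norm (F m x - F n x) \<partial>M) < e" if "e > 0" for e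
  proof -
    define c where "c = measure M (space M) + 1"
    have "c > 0" by (simp add: c_def add_nonneg_pos)
    with \<open>e > 0\<close> have "e\<^sup>2 / c > 0" by simp
    then obtain N where N: "\<And>m n. m \<ge> N \<Longrightarrow> n \<ge> N \<Longrightarrow> mean_square M (\<lambda>x. F m x - F n x) < e\<^sup>2 / c"
      using Cauchy unfolding mean_square_Cauchy_def by meson
    have "(\<integral>x. norm (F m x - F n x) \<partial>M) < e" if "m \<ge> N" "n \<ge> N" for m n
    proof (rule power2_less_imp_less)
      have "(\<integral>x. norm (F m x - F n x) \<partial>M)\<^sup>2 \<le> c * mean_square M (\<lambda>x. F m x - F n x)"
        using integral_norm_square_le[OF square_integrable_diff[OF F F], of m n]
          mean_square_nonneg[of M "\<lambda>x. F m x - F n x"] by (simp add: c_def algebra_simps)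
      also have "\<dots> < e\<^sup>2"
        using N[OF that] \<open>c > 0\<close> by (simp add: field_simps)
      finally show "(\<integral>x. norm (F m x - F n x) \<partial>M)\<^sup>2 < e\<^sup>2" .
    qed (use \<open>e > 0\<close> in simp)
    then show ?thesis by blast
  qed
  moreover have "integrable M (F n)" for n
    using F by (rule integrable_if_square_integrable)
  ultimately show thesis
    using cauchy_L1_AE_cauchy_subseq[of M F] that by blast
qed

theorem Riesz_Fischer:
  assumes F [measurable]: "\<And>n. square_integrable M (F n)" and Cauchy: "mean_square_Cauchy M F"
  obtains f where "square_integrable M f" "(\<lambda>n. mean_square M (\<lambda>x. F n x - f x)) \<longlonglongrightarrow> 0"
proof -
  obtain r where r: "strict_mono r" "AE x in M. Cauchy (\<lambda>k. F (r k) x)"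
    using mean_square_Cauchy_AE_Cauchy_subseq[OF F Cauchy] .
  define f where "f x = lim (\<lambda>k. F (r k) x)" for x
  have "f \<in> borel_measurable M"
    unfolding f_def[abs_def] by measurable
  moreover have "AE x in M. (\<lambda>k. F (r k) x) \<longlonglongrightarrow> f x"
    using r(2) by eventually_elim (simp add: f_def Cauchy_convergent_iff convergent_LIMSEQ_iff)
  ultimately show thesis
    using mean_square_Cauchy_tendsto[OF F Cauchy r(1)] that by blast
qed

end

section \<open>Density of bounded continuous functions\<close>

definition bounded_continuous :: "('a::topological_space \<Rightarrow> 'b::metric_space) \<Rightarrow> bool" where
  "bounded_continuous \<phi> \<longleftrightarrow> continuous_on UNIV \<phi> \<and> bounded (range \<phi>)"

definition Cb_approximable ::
    "'a::metric_space measure \<Rightarrow> ('a \<Rightarrow> 'b::{banach, second_countable_topology}) \<Rightarrow> bool" where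
  "Cb_approximable M f \<longleftrightarrow> square_integrable M f \<and>
    (\<forall>e>0. \<exists>\<phi>. bounded_continuous \<phi> \<and> mean_square M (\<lambda>x. \<phi> x - f x) < e)"

lemma Cb_approximableE:
  assumes "Cb_approximable M f" "e > 0"
  obtains \<phi> where "bounded_continuous \<phi>" "mean_square M (\<lambda>x. \<phi> x - f x) < e"
  using assms unfolding Cb_approximable_def by blast

lemma bounded_continuous_bound:
  fixes \<phi> :: "'a::topological_space \<Rightarrow> 'b::real_normed_vector"
  assumes "bounded_continuous \<phi>"
  obtains B where "\<And>x. norm (\<phi> x) \<le> B"
  using assms unfolding bounded_continuous_def bounded_iff by blast

lemma bounded_continuous_measurable:
  "bounded_continuous \<phi> \<Longrightarrow> \<phi> \<in> borel_measurable borel"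
  by (simp add: bounded_continuous_def borel_measurable_continuous_onI)

lemma bounded_continuous_const: "bounded_continuous (\<lambda>_. c)"
  by (simp add: bounded_continuous_def)

lemma bounded_continuous_add:
  fixes \<phi> \<psi> :: "'a::topological_space \<Rightarrow> 'b::real_normed_vector"
  shows "bounded_continuous \<phi> \<Longrightarrow> bounded_continuous \<psi> \<Longrightarrow> bounded_continuous (\<lambda>x. \<phi> x + \<psi> x)"
  by (auto simp: bounded_continuous_def intro!: continuous_on_add bounded_plus_comp)

lemma tent_tendsto_indicator:
  assumes "closed A" "A \<noteq> {}"
  shows "(\<lambda>n. max 0 (1 - real n * infdist x A)) \<longlonglongrightarrow> indicator A x"
proof (cases "x \<in> A")
  case False
  then have "infdist x A > 0"
    using assms by (simp add: infdist_pos_not_in_closed)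
  then obtain N where N: "1 < real N * infdist x A"
    using reals_Archimedean3 by blast
  have "max 0 (1 - real n * infdist x A) = 0" if "n \<ge> N" for n
  proof -
    have "real N * infdist x A \<le> real n * infdist x A"
      using that infdist_nonneg by (intro mult_right_mono) auto
    with N show ?thesis by simp
  qed
  with False show ?thesis
    by (auto intro!: tendsto_eventually eventually_sequentiallyI[of N])
qed simp

locale finite_borel_measure = finite_measure M for M :: "'a::metric_space measure" +
  assumes sets_eq_borel [measurable_cong]: "sets M = sets borel"
begin

lemma space_eq_UNIV [simp]: "space M = UNIV"
  using sets_eq_imp_space_eq[OF sets_eq_borel] by simp

lemma square_integrable_Cb:
  assumes "bounded_continuous \<phi>"
  shows "square_integrable M \<phi>"
proof -
  obtain B where "\<And>x. norm (\<phi> x) \<le> B"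
    using assms by (rule bounded_continuous_bound) blast
  moreover have "\<phi> \<in> borel_measurable M"
    using bounded_continuous_measurable[OF assms] by measurable
  ultimately show ?thesis
    by (intro square_integrable_bounded)
qed

lemma Cb_approximable_Cb: "bounded_continuous \<phi> \<Longrightarrow> Cb_approximable M \<phi>"
  unfolding Cb_approximable_def
  by (auto simp: square_integrable_Cb mean_square_def intro!: exI[of _ \<phi>])

lemma Cb_approximable_add:
  assumes f: "Cb_approximable M f" and g: "Cb_approximable M g"
  shows "Cb_approximable M (\<lambda>x. f x + g x)"
  unfolding Cb_approximable_def
proof (intro conjI allI impI)
  have sq: "square_integrable M f" "square_integrable M g"
    using f g by (simp_all add: Cb_approximable_def)
  then show "square_integrable M (\<lambda>x. f x + g x)"
    by (rule square_integrable_add)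
  fix e :: real assume "e > 0"
  then have "e / 4 > 0" by simp
  obtain \<phi> where \<phi>: "bounded_continuous \<phi>" "mean_square M (\<lambda>x. \<phi> x - f x) < e / 4"
    using f \<open>e / 4 > 0\<close> by (rule Cb_approximableE)
  obtain \<psi> where \<psi>: "bounded_continuous \<psi>" "mean_square M (\<lambda>x. \<psi> x - g x) < e / 4"
    using g \<open>e / 4 > 0\<close> by (rule Cb_approximableE)
  have "mean_square M (\<lambda>x. (\<phi> x - f x) + (\<psi> x - g x)) < e"
    using mean_square_add_le[OF square_integrable_diff[OF square_integrable_Cb sq(1)]
        square_integrable_diff[OF square_integrable_Cb sq(2)], of \<phi> \<psi>] \<phi> \<psi> by simp
  then show "\<exists>\<xi>. bounded_continuous \<xi> \<and> mean_square M (\<lambda>x. \<xi> x - (f x + g x)) < e"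
    using \<phi> \<psi>
    by (intro exI[of _ "\<lambda>x. \<phi> x + \<psi> x"]) (simp add: bounded_continuous_add algebra_simps)
qed

lemma Cb_approximable_limit:
  assumes F: "\<And>n. Cb_approximable M (F n)" and f: "f \<in> borel_measurable M"
    and lim: "\<And>x. (\<lambda>n. F n x) \<longlonglongrightarrow> f x"
    and bound: "\<And>n x. norm (F n x) \<le> w x"
    and w: "integrable M (\<lambda>x. (w x)\<^sup>2)"
  shows "Cb_approximable M f"
  unfolding Cb_approximable_def
proof (intro conjI allI impI)
  have sqF: "square_integrable M (F n)" for n
    using F by (simp add: Cb_approximable_def)
  have "norm (f x) \<le> w x" for x
    by (intro LIMSEQ_le_const2[OF tendsto_norm[OF lim]]) (auto simp: bound)
  then show sqf: "square_integrable M f"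
    by (intro square_integrable_bound[OF f w]) (auto intro!: power_mono)
  fix e :: real assume "e > 0"
  have "(\<lambda>n. mean_square M (\<lambda>x. F n x - f x)) \<longlonglongrightarrow> 0"
    by (rule tendsto_mean_square_dominated[OF square_integrable_measurable[OF sqF] f lim bound w])
  with \<open>e > 0\<close> have "\<forall>\<^sub>F n in sequentially. mean_square M (\<lambda>x. F n x - f x) < e / 4"
    by (intro order_tendstoD) auto
  then obtain n where n: "mean_square M (\<lambda>x. F n x - f x) < e / 4"
    by (auto simp: eventually_sequentially)
  obtain \<phi> where \<phi>: "bounded_continuous \<phi>" "mean_square M (\<lambda>x. \<phi> x - F n x) < e / 4"
    using Cb_approximableE[OF F, of "e / 4"] \<open>e > 0\<close> by auto
  have "mean_square M (\<lambda>x. (\<phi> x - F n x) + (F n x - f x)) < e"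
    using mean_square_add_le[OF square_integrable_diff[OF square_integrable_Cb sqF]
        square_integrable_diff[OF sqF sqf], of \<phi> n n] \<phi> n by simp
  with \<phi> show "\<exists>\<phi>. bounded_continuous \<phi> \<and> mean_square M (\<lambda>x. \<phi> x - f x) < e"
    by auto
qed

lemma Cb_approximable_indicator_closed:
  assumes "closed A"
  shows "Cb_approximable M (\<lambda>x. indicator A x *\<^sub>R c)"
proof (cases "A = {}")
  case True
  then show ?thesis
    using Cb_approximable_Cb[OF bounded_continuous_const[of 0]] by simp
next
  case False
  define F where "F n x = max 0 (1 - real n * infdist x A) *\<^sub>R c" for n x
  have bound: "norm (F n x) \<le> norm c" for n x
    using infdist_nonneg[of x A] by (auto simp: F_def intro!: mult_left_le_one_le)
  show ?thesis
  proof (rule Cb_approximable_limit)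
    have "continuous_on UNIV (F n)" for n
      unfolding F_def by (intro continuous_intros)
    then show "Cb_approximable M (F n)" for n
      using bound by (intro Cb_approximable_Cb) (auto simp: bounded_continuous_def bounded_iff)
    show "(\<lambda>x. indicator A x *\<^sub>R c) \<in> borel_measurable M"
      using borel_closed[OF assms] by measurable
    show "(\<lambda>n. F n x) \<longlonglongrightarrow> indicator A x *\<^sub>R c" for x
      unfolding F_def by (intro tendsto_intros tent_tendsto_indicator assms False)
  qed (rule bound, simp)
qed

lemma Cb_approximable_indicator_UN:
  assumes A: "\<And>i::nat. Cb_approximable M (\<lambda>x. indicator (A i) x *\<^sub>R c)"
    and "disjoint_family A" and [measurable]: "\<And>i. A i \<in> sets borel"
  shows "Cb_approximable M (\<lambda>x. indicator (\<Union>i. A i) x *\<^sub>R c)"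
proof (rule Cb_approximable_limit)
  show "Cb_approximable M (\<lambda>x. indicator (\<Union>i<n. A i) x *\<^sub>R c)" for n
  proof (induction n)
    case 0
    then show ?case
      using Cb_approximable_Cb[OF bounded_continuous_const[of 0]] by simp
  next
    case (Suc n)
    have "A n \<inter> A i = {}" if "i < n" for i
      using assms(2) that by (intro disjoint_family_onD) auto
    then have "A n \<inter> (\<Union>i<n. A i) = {}"
      by blast
    then show ?case
      using Cb_approximable_add[OF A[of n] Suc]
      by (simp add: lessThan_Suc indicator_disj_union scaleR_add_left)
  qed
  show "(\<lambda>n. indicator (\<Union>i<n. A i) x *\<^sub>R c) \<longlonglongrightarrow> indicator (\<Union>i. A i) x *\<^sub>R c" for x
    by (intro tendsto_intros LIMSEQ_indicator_UN)
  show "norm (indicator (\<Union>i<n. A i) x *\<^sub>R c) \<le> norm c" for n x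
    by (simp add: indicator_def)
qed simp_all

lemma Cb_approximable_indicator:
  fixes c :: "'b::{banach, second_countable_topology}"
  assumes "A \<in> sets borel"
  shows "Cb_approximable M (\<lambda>x. indicator A x *\<^sub>R c)"
proof -
  have "Int_stable {A :: 'a set. closed A}" "{A :: 'a set. closed A} \<subseteq> Pow UNIV"
    by (auto simp: Int_stable_def)
  moreover have "A \<in> sigma_sets UNIV {A. closed A}"
    using assms by (simp add: borel_eq_closed)
  ultimately have "\<forall>c::'b. Cb_approximable M (\<lambda>x. indicator A x *\<^sub>R c)"
  proof (induction rule: sigma_sets_induct_disjoint)
    case (basic A)
    then show ?case by (simp add: Cb_approximable_indicator_closed)
  next
    case empty
    then show ?case
      using Cb_approximable_Cb[OF bounded_continuous_const[of 0]] by simp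
  next
    case (compl A)
    show ?case
    proof
      fix c :: 'b
      have "Cb_approximable M (\<lambda>x. c + indicator A x *\<^sub>R (- c))"
        by (intro Cb_approximable_add[OF Cb_approximable_Cb compl.IH[rule_format]]
            bounded_continuous_const)
      then show "Cb_approximable M (\<lambda>x. indicator (UNIV - A) x *\<^sub>R c)"
        by (rule back_subst[of "Cb_approximable M"]) (auto simp: indicator_def)
    qed
  next
    case (union A)
    then have "A i \<in> sets borel" for i
      by (auto simp: borel_eq_closed)
    with union show ?case
      by (intro allI Cb_approximable_indicator_UN) auto
  qed
  then show ?thesis ..
qed

theorem square_integrable_imp_Cb_approximable:
  assumes f: "square_integrable M f"
  shows "Cb_approximable M f"
proof -
  obtain F where F: "\<And>n. simple_function M (F n)" "\<And>x. (\<lambda>n. F n x) \<longlonglongrightarrow> f x"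
    "\<And>n x. norm (F n x) \<le> 2 * norm (f x)"
    using borel_measurable_implies_sequence_metric[OF square_integrable_measurable[OF f], of 0]
    by auto
  have simple: "Cb_approximable M s" if "simple_function M s" for s
  proof -
    have "emeasure M {x \<in> space M. s x \<noteq> 0} \<noteq> \<infinity>"
      by simp
    with that show ?thesis
    proof (induction rule: integrable_simple_function_induct)
      case (cong s t)
      then show ?case by (metis UNIV_I ext space_eq_UNIV)
    next
      case (indicator A c)
      then show ?case
        using Cb_approximable_indicator sets_eq_borel by blast
    next
      case (add s t)
      then show ?case by (intro Cb_approximable_add)
    qed
  qed
  show ?thesis
  proof (rule Cb_approximable_limit)
    show "integrable M (\<lambda>x. (2 * norm (f x))\<^sup>2)"
      using square_integrable_norm_square[OF f] by (simp add: power_mult_distrib)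
  qed (rule simple[OF F(1)] square_integrable_measurable[OF f] F(2,3))+
qed

end

section \<open>The Hilbert space of square integrable functions\<close>

lemma sets_gauss [measurable_cong, simp]: "sets gauss = sets borel"
  by (simp add: gauss_def)

lemma prob_space_gauss: "prob_space gauss"
proof
  have "emeasure gauss (space gauss) = (\<integral>\<^sup>+z. ennreal (exp (- ((cmod z)\<^sup>2) / 2) / (2 * pi)) \<partial>lborel)"
    by (simp add: gauss_def emeasure_density)
  also have "\<dots> = (\<integral>\<^sup>+(z::complex). (\<Prod>b\<in>Basis. ennreal (std_normal_density (inner z b))) \<partial>lborel)"
  proof (rule nn_integral_cong)
    fix z :: complex
    have "exp (- ((cmod z)\<^sup>2) / 2) = exp (- ((Re z)\<^sup>2) / 2) * exp (- ((Im z)\<^sup>2) / 2)"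
      unfolding exp_add[symmetric] cmod_power2 by (simp add: add_divide_distrib)
    then have "exp (- ((cmod z)\<^sup>2) / 2) / (2 * pi) =
        std_normal_density (Re z) * std_normal_density (Im z)"
      by (simp add: std_normal_density_def)
    then show "ennreal (exp (- ((cmod z)\<^sup>2) / 2) / (2 * pi)) =
        (\<Prod>b\<in>Basis. ennreal (std_normal_density (inner z b)))"
      by (simp add: Basis_complex_def ennreal_mult)
  qed
  also have "\<dots> = (\<Prod>b\<in>(Basis::complex set). (\<integral>\<^sup>+x. ennreal (std_normal_density x) \<partial>lborel))"
    by (rule nn_integral_lborel_prod) auto
  also have "(\<integral>\<^sup>+x. ennreal (std_normal_density x) \<partial>lborel) = 1"
    by (subst nn_integral_eq_integral)
       (auto intro: integrable_normal_density simp: integral_normal_density)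
  finally show "emeasure gauss (space gauss) = 1" by simp
qed

interpretation gauss: prob_space gauss
  by (rule prob_space_gauss)

interpretation gauss: finite_borel_measure gauss
  by unfold_locales simp

lemma L2_eq: "L2 = square_integrable gauss"
  by (simp add: fun_eq_iff L2_def square_integrable_def)

lemma L2norm_eq: "L2norm f = sqrt (mean_square gauss f)"
  by (simp add: L2norm_def mean_square_def)

lemma Cb_eq: "Cb = bounded_continuous"
  by (simp add: fun_eq_iff Cb_def bounded_continuous_def)

lemma Cb_imp_L2: "Cb \<phi> \<Longrightarrow> L2 \<phi>"
  by (simp add: Cb_eq L2_eq gauss.square_integrable_Cb)

lemma L2_mult: "L2 f \<Longrightarrow> L2 (\<lambda>x. c * f x)"
  unfolding L2_eq by (rule square_integrable_bounded_linear[OF bounded_linear_mult_right])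

lemma L2_scaleR: "L2 f \<Longrightarrow> L2 (\<lambda>x. r *\<^sub>R f x)"
  unfolding L2_eq by (rule square_integrable_bounded_linear[OF bounded_linear_scaleR_right])

lemma L2_const: "L2 (\<lambda>_. c)"
  by (simp add: L2_eq gauss.square_integrable_const)

lemma L2_measurable: "L2 f \<Longrightarrow> f \<in> borel_measurable borel"
  by (auto simp: L2_eq dest: square_integrable_measurable)

lemmas L2_norm_square = square_integrable_norm_square[where M = gauss and 'b = complex, folded L2_eq]
  and L2_integrable_mult_cnj = integrable_mult_cnj[where M = gauss, folded L2_eq]
  and L2_integrable = gauss.integrable_if_square_integrable[where 'b = complex, folded L2_eq]
  and L2_add = square_integrable_add[where M = gauss and 'b = complex, folded L2_eq]
  and L2_uminus = square_integrable_uminus[where M = gauss and 'b = complex, folded L2_eq]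
  and L2_diff = square_integrable_diff[where M = gauss and 'b = complex, folded L2_eq]

lemma Re_L2inner_self: "Re (L2inner f f) = mean_square gauss f"
  unfolding L2inner_def mean_square_def complex_norm_square[symmetric]
  by (simp flip: of_real_power)

lemma L2inner_commute: "L2inner g f = cnj (L2inner f g)"
  unfolding L2inner_def by (simp add: mult.commute flip: Bochner_Integration.integral_cnj)

definition L2eq :: "(complex \<Rightarrow> complex) \<Rightarrow> (complex \<Rightarrow> complex) \<Rightarrow> bool" where
  "L2eq f g \<longleftrightarrow> L2 f \<and> L2 g \<and> (AE x in gauss. f x = g x)"

quotient_type l2 = "complex \<Rightarrow> complex" / partial: L2eq
  morphisms rep_l2 cls
proof (rule part_equivpI)
  show "\<exists>f. L2eq f f"
    by (rule exI[of _ "\<lambda>_. 0"]) (simp add: L2eq_def L2_const)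
  show "symp L2eq"
    by (auto simp: symp_def L2eq_def elim: AE_mp)
  show "transp L2eq"
    by (auto simp: transp_def L2eq_def)
qed

instantiation l2 :: real_inner
begin

lift_definition zero_l2 :: l2 is "\<lambda>_. 0"
  by (simp add: L2eq_def L2_const)
lift_definition plus_l2 :: "l2 \<Rightarrow> l2 \<Rightarrow> l2" is "\<lambda>f g x. f x + g x"
  by (auto simp: L2eq_def L2_add)
lift_definition minus_l2 :: "l2 \<Rightarrow> l2 \<Rightarrow> l2" is "\<lambda>f g x. f x - g x"
  by (auto simp: L2eq_def L2_diff)
lift_definition uminus_l2 :: "l2 \<Rightarrow> l2" is "\<lambda>f x. - f x"
  by (auto simp: L2eq_def L2_uminus)
lift_definition scaleR_l2 :: "real \<Rightarrow> l2 \<Rightarrow> l2" is "\<lambda>r f x. r *\<^sub>R f x"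
  by (auto simp: L2eq_def L2_scaleR)
lift_definition inner_l2 :: "l2 \<Rightarrow> l2 \<Rightarrow> real" is "\<lambda>f g. Re (L2inner f g)"
proof -
  fix f f' g g' assume eq: "L2eq f f'" "L2eq g g'"
  then have "(\<lambda>x. f x * cnj (g x)) \<in> borel_measurable gauss"
      "(\<lambda>x. f' x * cnj (g' x)) \<in> borel_measurable gauss"
    by (auto simp: L2eq_def intro!: borel_measurable_integrable[OF L2_integrable_mult_cnj])
  then have "L2inner f g = L2inner f' g'"
    unfolding L2inner_def using eq by (intro integral_cong_AE) (auto simp: L2eq_def)
  then show "Re (L2inner f g) = Re (L2inner f' g')"
    by simp
qed

definition norm_l2 :: "l2 \<Rightarrow> real" where "norm_l2 x = sqrt (inner x x)"
definition dist_l2 :: "l2 \<Rightarrow> l2 \<Rightarrow> real" where "dist_l2 x y = norm (x - y)"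
definition sgn_l2 :: "l2 \<Rightarrow> l2" where "sgn_l2 x = scaleR (inverse (norm x)) x"
definition uniformity_l2 :: "(l2 \<times> l2) filter" where
  "uniformity_l2 = (INF e\<in>{0 <..}. principal {(x, y). dist x y < e})"
definition open_l2 :: "l2 set \<Rightarrow> bool" where
  "open_l2 U \<longleftrightarrow> (\<forall>x\<in>U. \<forall>\<^sub>F (x', y) in uniformity. x' = x \<longrightarrow> y \<in> U)"

instance
proof
  fix x y z :: l2 and a b :: real
  show "x + y + z = x + (y + z)" by transfer (simp add: L2eq_def L2_add add.assoc)
  show "x + y = y + x" by transfer (simp add: L2eq_def L2_add add.commute)
  show "0 + x = x" by transfer (simp add: L2eq_def)
  show "- x + x = 0" by transfer (simp add: L2eq_def L2_const)
  show "x - y = x + - y" by transfer (simp add: L2eq_def L2_diff)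
  show "a *\<^sub>R (x + y) = a *\<^sub>R x + a *\<^sub>R y"
    by transfer (simp add: L2eq_def L2_add L2_scaleR scaleR_add_right)
  show "(a + b) *\<^sub>R x = a *\<^sub>R x + b *\<^sub>R x"
    by transfer (simp add: L2eq_def L2_add L2_scaleR scaleR_add_left)
  show "a *\<^sub>R b *\<^sub>R x = (a * b) *\<^sub>R x" by transfer (simp add: L2eq_def L2_scaleR)
  show "1 *\<^sub>R x = x" by transfer (simp add: L2eq_def)
  show "inner x y = inner y x"
    by transfer (subst L2inner_commute, simp)
  show "inner (x + y) z = inner x z + inner y z"
    by transfer (simp add: L2inner_def L2eq_def distrib_right L2_integrable_mult_cnj)
  show "inner (a *\<^sub>R x) y = a * inner x y"
    by transfer (simp add: L2inner_def)
  show "0 \<le> inner x x"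
    by transfer (simp add: Re_L2inner_self mean_square_nonneg)
  show "(inner x x = 0) = (x = 0)"
    by transfer (simp add: Re_L2inner_self mean_square_def L2eq_def L2_const L2_norm_square
        integral_nonneg_eq_0_iff_AE)
qed (simp_all add: norm_l2_def dist_l2_def sgn_l2_def uniformity_l2_def open_l2_def)

end

lemma
  shows L2_rep_l2: "L2 (rep_l2 x)" and cls_rep_l2: "cls (rep_l2 x) = x"
  using Quotient_rep_reflp[OF Quotient_l2, of x] Quotient_abs_rep[OF Quotient_l2]
  by (simp_all add: L2eq_def)

lemma l2_cases [cases type]: obtains f where "x = cls f" "L2 f"
  using L2_rep_l2[of x] cls_rep_l2[of x] by metis

lemma ex_L2_cls_iff: "(\<exists>f. L2 f \<and> P (cls f)) \<longleftrightarrow> (\<exists>x. P x)"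
  by (metis l2_cases)

lemma cls_eq_iff: "L2 f \<Longrightarrow> L2 g \<Longrightarrow> cls f = cls g \<longleftrightarrow> (AE x in gauss. f x = g x)"
  using Quotient_rel[OF Quotient_l2, of f g] by (auto simp: L2eq_def)

lemma cls_add: "L2 f \<Longrightarrow> L2 g \<Longrightarrow> cls (\<lambda>x. f x + g x) = cls f + cls g"
  by (simp add: plus_l2.abs_eq L2eq_def)

lemma cls_diff: "L2 f \<Longrightarrow> L2 g \<Longrightarrow> cls (\<lambda>x. f x - g x) = cls f - cls g"
  by (simp add: minus_l2.abs_eq L2eq_def)

lemma cls_scaleR: "L2 f \<Longrightarrow> cls (\<lambda>x. r *\<^sub>R f x) = r *\<^sub>R cls f"
  by (simp add: scaleR_l2.abs_eq L2eq_def)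

lemma inner_cls: "L2 f \<Longrightarrow> L2 g \<Longrightarrow> inner (cls f) (cls g) = Re (L2inner f g)"
  by (simp add: inner_l2.abs_eq L2eq_def)

lemma norm_cls: "L2 f \<Longrightarrow> norm (cls f) = L2norm f"
  by (simp add: norm_l2_def inner_cls L2norm_eq Re_L2inner_self)

lemma norm_cls_diff: "L2 f \<Longrightarrow> L2 g \<Longrightarrow> norm (cls f - cls g) = L2norm (\<lambda>x. f x - g x)"
  by (simp add: norm_cls L2_diff flip: cls_diff)

lemma mean_square_diff_eq_dist:
  "L2 f \<Longrightarrow> L2 g \<Longrightarrow> mean_square gauss (\<lambda>x. f x - g x) = (dist (cls f) (cls g))\<^sup>2"
  by (simp add: dist_norm norm_cls_diff L2norm_eq mean_square_nonneg)

lemma tendsto_cls_iff: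
  assumes "\<forall>\<^sub>F i in G. L2 (F i)" "L2 f"
  shows "((\<lambda>i. cls (F i)) \<longlongrightarrow> cls f) G \<longleftrightarrow> ((\<lambda>i. L2norm (\<lambda>x. F i x - f x)) \<longlongrightarrow> 0) G"
proof -
  have "((\<lambda>i. cls (F i)) \<longlongrightarrow> cls f) G \<longleftrightarrow> ((\<lambda>i. norm (cls (F i) - cls f)) \<longlongrightarrow> 0) G"
    by (simp add: tendsto_norm_zero_iff LIM_zero_iff)
  also have "\<dots> \<longleftrightarrow> ((\<lambda>i. L2norm (\<lambda>x. F i x - f x)) \<longlongrightarrow> 0) G"
    using assms by (intro filterlim_cong refl) (auto elim: eventually_mono simp: norm_cls_diff)
  finally show ?thesis .
qed

instance l2 :: banach
proof
  fix X :: "nat \<Rightarrow> l2" assume "Cauchy X"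
  have "mean_square_Cauchy gauss (\<lambda>n. rep_l2 (X n))"
    unfolding mean_square_Cauchy_def
  proof (intro allI impI)
    fix e :: real assume "e > 0"
    obtain N where N: "\<And>m n. m \<ge> N \<Longrightarrow> n \<ge> N \<Longrightarrow> dist (X m) (X n) < sqrt e"
      using \<open>Cauchy X\<close> \<open>e > 0\<close> unfolding Cauchy_def by (metis real_sqrt_gt_zero)
    have "(dist (X m) (X n))\<^sup>2 < e" if "m \<ge> N" "n \<ge> N" for m n
      using power_strict_mono[OF N[OF that], of 2] \<open>e > 0\<close> by simp
    then show "\<exists>N. \<forall>m\<ge>N. \<forall>n\<ge>N. mean_square gauss (\<lambda>x. rep_l2 (X m) x - rep_l2 (X n) x) < e"
      by (auto simp: mean_square_diff_eq_dist L2_rep_l2 cls_rep_l2)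
  qed
  then obtain f where f: "L2 f" "(\<lambda>n. mean_square gauss (\<lambda>x. rep_l2 (X n) x - f x)) \<longlonglongrightarrow> 0"
    using gauss.Riesz_Fischer[of "\<lambda>n. rep_l2 (X n)"] L2_rep_l2 unfolding L2_eq by blast
  from tendsto_real_sqrt[OF f(2)] have "(\<lambda>n. cls (rep_l2 (X n))) \<longlonglongrightarrow> cls f"
    by (simp add: tendsto_cls_iff L2_rep_l2 f(1) L2norm_eq)
  then show "convergent X"
    by (simp add: cls_rep_l2 convergentI)
qed

lemma cls_Cb_dense: "closure (cls ` Collect Cb) = UNIV"
proof -
  have "x \<in> closure (cls ` Collect Cb)" for x
    unfolding closure_approachable
  proof (intro allI impI)
    fix e :: real assume "e > 0"
    then have "e\<^sup>2 > 0" by simp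
    obtain f where f: "x = cls f" "L2 f" by (cases x)
    then have "Cb_approximable gauss f"
      unfolding L2_eq by (intro gauss.square_integrable_imp_Cb_approximable)
    then obtain \<phi> where \<phi>: "Cb \<phi>" "mean_square gauss (\<lambda>x. \<phi> x - f x) < e\<^sup>2"
      using \<open>e\<^sup>2 > 0\<close> unfolding Cb_eq by (rule Cb_approximableE)
    then have "dist (cls \<phi>) x < e"
      using f \<open>e > 0\<close>
      by (intro power2_less_imp_less[of _ e]) (simp_all add: mean_square_diff_eq_dist Cb_imp_L2)
    with \<phi>(1) show "\<exists>y\<in>cls ` Collect Cb. dist y x < e"
      by blast
  qed
  then show ?thesis by auto
qed

lift_definition imul :: "l2 \<Rightarrow> l2" is "\<lambda>f x. \<i> * f x"
  by (auto simp: L2eq_def L2_mult)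

lemma imul_cls: "L2 f \<Longrightarrow> imul (cls f) = cls (\<lambda>x. \<i> * f x)"
  by (simp add: imul.abs_eq L2eq_def)

lemma norm_imul: "norm (imul x) = norm x"
  by (cases x) (simp add: imul_cls norm_cls L2_mult L2norm_def norm_mult)

lemma bounded_linear_imul: "bounded_linear imul"
proof (rule bounded_linear_intro[of _ 1])
  fix x y :: l2 and r :: real
  show "imul (x + y) = imul x + imul y"
    by (cases x, cases y) (simp add: imul_cls L2_add L2_mult distrib_left flip: cls_add)
  show "imul (r *\<^sub>R x) = r *\<^sub>R imul x"
    by (cases x) (simp add: imul_cls L2_scaleR L2_mult flip: cls_scaleR)
qed (simp add: norm_imul)

lemma L2inner_eq_iff:
  assumes "L2 f" "L2 g" "L2 f'" "L2 g'"
  shows "L2inner f g = L2inner f' g' \<longleftrightarrow>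
    inner (cls f) (cls g) = inner (cls f') (cls g') \<and>
    inner (imul (cls f)) (cls g) = inner (imul (cls f')) (cls g')"
proof -
  have "Re (L2inner (\<lambda>x. \<i> * f x) g) = - Im (L2inner f g)" for f g
    by (simp add: L2inner_def mult.assoc)
  then show ?thesis
    using assms by (simp add: imul_cls inner_cls L2_mult complex_eq_iff)
qed

section \<open>Rotations of independent Gaussian variables\<close>

definition noise :: "complex \<Rightarrow> real" where
  "noise a = sqrt (1 - (cmod a)\<^sup>2)"

definition mix :: "complex \<Rightarrow> complex \<times> complex \<Rightarrow> complex" where
  "mix a p = a * fst p + of_real (noise a) * snd p"

definition rot :: "complex \<Rightarrow> complex \<times> complex \<Rightarrow> complex \<times> complex" where
  "rot a p = (mix a p, of_real (noise a) * fst p - cnj a * snd p)"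

lemma noise_cnj [simp]: "noise (cnj a) = noise a"
  by (simp add: noise_def)

lemma mix_1 [simp]: "mix 1 p = fst p"
  by (simp add: mix_def noise_def)

lemma noise_square: "cmod a \<le> 1 \<Longrightarrow> (noise a)\<^sup>2 = 1 - (cmod a)\<^sup>2"
  by (simp add: noise_def abs_square_le_1)

lemma complex_noise_square: "cmod a \<le> 1 \<Longrightarrow> (complex_of_real (noise a))\<^sup>2 + a * cnj a = 1"
  by (simp add: noise_square complex_norm_square[symmetric] flip: of_real_power of_real_add)

lemma cmod_mult_le_1: "cmod a \<le> 1 \<Longrightarrow> cmod b \<le> 1 \<Longrightarrow> cmod (a * b) \<le> 1"
  by (simp add: norm_mult mult_le_one)

lemma mix_cnj_rot: "cmod a \<le> 1 \<Longrightarrow> mix (cnj a) (rot a p) = fst p"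
  using complex_noise_square[of a] unfolding mix_def rot_def by (simp, algebra)

lemma norm_rot:
  assumes "cmod a \<le> 1"
  shows "norm (rot a p) = norm p"
proof -
  have "complex_of_real ((cmod (fst (rot a p)))\<^sup>2 + (cmod (snd (rot a p)))\<^sup>2) =
        complex_of_real ((cmod (fst p))\<^sup>2 + (cmod (snd p))\<^sup>2)"
    unfolding of_real_add complex_norm_square rot_def mix_def
    using complex_noise_square[OF assms] by (simp, algebra)
  then show ?thesis
    by (simp only: norm_prod_def of_real_eq_iff)
qed

lemma measurable_mix [measurable]: "mix a \<in> borel_measurable borel"
  unfolding mix_def[abs_def] by (intro borel_measurable_continuous_onI continuous_intros)

lemma measurable_rot [measurable]: "rot a \<in> borel_measurable borel"
  unfolding rot_def[abs_def] mix_def[abs_def]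
  by (intro borel_measurable_continuous_onI continuous_intros)

lemma nn_integral_lborel_complex_affine:
  fixes c :: real and t :: complex
  assumes [measurable]: "f \<in> borel_measurable borel" and "c \<noteq> 0"
  shows "(\<integral>\<^sup>+z. f z \<partial>lborel) = ennreal (c\<^sup>2) * (\<integral>\<^sup>+z. f (t + of_real c * z) \<partial>lborel)"
  by (subst lborel_affine[OF \<open>c \<noteq> 0\<close>, of t])
     (simp add: nn_integral_density nn_integral_distr nn_integral_cmult scaleR_conv_of_real)

text \<open>Substituting \<open>u = a x + s y\<close> for \<open>y\<close> and then \<open>v = (x - cnj a u) / s\<close> for \<open>x\<close>, where
  \<open>s = noise a\<close>, only takes real dilations.\<close>
lemma nn_integral_lborel_rot:
  assumes a: "cmod a < 1" and [measurable]: "F \<in> borel_measurable borel"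
  shows "(\<integral>\<^sup>+x. \<integral>\<^sup>+y. F (rot a (x, y)) \<partial>lborel \<partial>lborel) = (\<integral>\<^sup>+u. \<integral>\<^sup>+v. F (u, v) \<partial>lborel \<partial>lborel)"
proof -
  define s where "s = noise a"
  have s: "s > 0"
    using a by (simp add: s_def noise_def abs_square_less_1)
  have "ennreal (s\<^sup>2) * (\<integral>\<^sup>+x. \<integral>\<^sup>+y. F (rot a (x, y)) \<partial>lborel \<partial>lborel) =
      (\<integral>\<^sup>+x. ennreal (s\<^sup>2) * (\<integral>\<^sup>+y. F (rot a (x, y)) \<partial>lborel) \<partial>lborel)"
    by (simp add: nn_integral_cmult)
  also have "\<dots> = (\<integral>\<^sup>+x. \<integral>\<^sup>+u. F (u, (x - cnj a * u) / of_real s) \<partial>lborel \<partial>lborel)"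
  proof (rule nn_integral_cong)
    fix x
    have "rot a (x, y) =
        (a * x + of_real s * y, (x - cnj a * (a * x + of_real s * y)) / of_real s)" for y
      using mix_cnj_rot[of a "(x, y)"] a s by (simp add: rot_def mix_def s_def field_simps)
    then show "ennreal (s\<^sup>2) * (\<integral>\<^sup>+y. F (rot a (x, y)) \<partial>lborel) =
        (\<integral>\<^sup>+u. F (u, (x - cnj a * u) / of_real s) \<partial>lborel)"
      using s by (subst nn_integral_lborel_complex_affine[of _ s "a * x"]) auto
  qed
  also have "\<dots> = (\<integral>\<^sup>+u. \<integral>\<^sup>+x. F (u, (x - cnj a * u) / of_real s) \<partial>lborel \<partial>lborel)"
    by (rule lborel_pair.Fubini') measurable
  also have "\<dots> = (\<integral>\<^sup>+u. ennreal (s\<^sup>2) * (\<integral>\<^sup>+v. F (u, v) \<partial>lborel) \<partial>lborel)"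
  proof (rule nn_integral_cong)
    show "(\<integral>\<^sup>+x. F (u, (x - cnj a * u) / of_real s) \<partial>lborel) =
        ennreal (s\<^sup>2) * (\<integral>\<^sup>+v. F (u, v) \<partial>lborel)" for u
      using s by (subst nn_integral_lborel_complex_affine[of _ s "cnj a * u"]) auto
  qed
  also have "\<dots> = ennreal (s\<^sup>2) * (\<integral>\<^sup>+u. \<integral>\<^sup>+v. F (u, v) \<partial>lborel \<partial>lborel)"
    by (simp add: nn_integral_cmult)
  finally show ?thesis
    using s by (simp add: ennreal_mult_cancel_left)
qed

lemma distr_lborel_rot:
  assumes "cmod a < 1"
  shows "distr lborel borel (rot a) = lborel"
proof (rule measure_eqI)
  fix A assume "A \<in> sets (distr lborel borel (rot a))"
  then have [measurable]: "A \<in> sets borel" by simp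
  have iterated: "(\<integral>\<^sup>+p. F p \<partial>lborel) = (\<integral>\<^sup>+x. \<integral>\<^sup>+y. F (x, y) \<partial>lborel \<partial>lborel)"
    if "F \<in> borel_measurable borel" for F :: "complex \<times> complex \<Rightarrow> ennreal"
    using that by (simp add: lborel.nn_integral_fst lborel_prod)
  have "emeasure (distr lborel borel (rot a)) A = (\<integral>\<^sup>+p. indicator A (rot a p) \<partial>lborel)"
    by (simp add: nn_integral_distr flip: nn_integral_indicator)
  also have "\<dots> = (\<integral>\<^sup>+p. indicator A p \<partial>lborel)"
    using nn_integral_lborel_rot[OF assms, of "indicator A"]
    by (simp add: iterated del: nn_integral_indicator)
  finally show "emeasure (distr lborel borel (rot a)) A = emeasure lborel A"
    by simp
qed simp

abbreviation gauss2 :: "(complex \<times> complex) measure" where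
  "gauss2 \<equiv> gauss \<Otimes>\<^sub>M gauss"

interpretation gauss2: pair_prob_space gauss gauss ..

lemma sets_gauss2 [measurable_cong]: "sets gauss2 = sets borel"
  by (metis borel_prod sets_gauss sets_pair_measure_cong)

lemma gauss2_eq_density:
  "gauss2 = density lborel (\<lambda>p. ennreal (exp (- ((norm p)\<^sup>2) / 2) / (2 * pi)\<^sup>2))"
proof -
  let ?w = "\<lambda>z. ennreal (exp (- ((cmod z)\<^sup>2) / 2) / (2 * pi))"
  have "gauss2 = density (lborel \<Otimes>\<^sub>M lborel) (\<lambda>(x, y). ?w x * ?w y)"
    unfolding gauss_def
    using gauss.sigma_finite_measure_axioms
    by (intro pair_measure_density lborel.sigma_finite_measure_axioms) (simp_all add: gauss_def)
  also have "(\<lambda>(x, y). ?w x * ?w y) = (\<lambda>p. ennreal (exp (- ((norm p)\<^sup>2) / 2) / (2 * pi)\<^sup>2))"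
    by (auto simp: fun_eq_iff norm_prod_def ennreal_mult[symmetric] exp_add[symmetric]
        power2_eq_square field_simps)
  finally show ?thesis
    by (simp add: lborel_prod)
qed

lemma distr_gauss2_rot_less:
  assumes "cmod a < 1"
  shows "distr gauss2 gauss2 (rot a) = gauss2"
proof -
  let ?w = "\<lambda>p :: complex \<times> complex. ennreal (exp (- ((norm p)\<^sup>2) / 2) / (2 * pi)\<^sup>2)"
  have "distr gauss2 gauss2 (rot a) = distr (density lborel (\<lambda>p. ?w (rot a p))) borel (rot a)"
    using assms by (intro distr_cong[OF _ sets_gauss2]) (simp_all add: gauss2_eq_density norm_rot)
  also have "\<dots> = density (distr lborel borel (rot a)) ?w"
    by (rule density_distr[symmetric]) measurable
  also have "\<dots> = gauss2"
    by (simp add: distr_lborel_rot[OF assms] gauss2_eq_density)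
  finally show ?thesis .
qed

text \<open>The substitution behind \<open>nn_integral_lborel_rot\<close> divides by \<open>noise a\<close>. This factorization reduces the
  unit circle, where \<open>noise a\<close> vanishes, to the open disc.\<close>
lemma rot_unit_circle:
  assumes "cmod a = 1" and s: "s = complex_of_real (sqrt (1 / 2))"
  shows "rot a p = rot (a * s) (rot (- cnj a * s) (rot 0 p))"
proof -
  have rot_s: "rot (c * s) (u, v) = (s * (c * u + v), s * (u - cnj c * v))" if "cmod c = 1" for c u v
  proof -
    have "(cmod s)\<^sup>2 = 1 / 2"
      by (simp add: s norm_divide power_divide)
    with that have "complex_of_real (noise (c * s)) = s"
      by (simp add: noise_def norm_mult power_mult_distrib s)
    moreover have "cnj s = s"
      by (simp add: s)
    ultimately show ?thesis
      by (simp add: rot_def mix_def algebra_simps)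
  qed
  have "s * s = 1 / 2" "a * cnj a = 1"
    using assms by (simp_all add: complex_norm_square[symmetric] flip: of_real_mult)
  then have cancel: "s * (a * (s * (- cnj a * y + x)) + s * (y + a * x)) = a * x"
    "s * (s * (- cnj a * y + x) - cnj a * (s * (y + a * x))) = - cnj a * y" for x y
    by algebra+
  have "rot (a * s) (rot (- cnj a * s) (y, x)) = (a * x, - cnj a * y)" for x y
    using assms(1) cancel by (simp only: rot_s norm_minus_cancel complex_mod_cnj) simp
  moreover have "rot 0 p = (snd p, fst p)" "rot a p = (a * fst p, - cnj a * snd p)"
    using assms(1) by (simp_all add: rot_def mix_def noise_def)
  ultimately show ?thesis
    by simp
qed

lemma distr_gauss2_rot:
  assumes "cmod a \<le> 1"
  shows "distr gauss2 gauss2 (rot a) = gauss2"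
proof (cases "cmod a = 1")
  case True
  define s where "s = complex_of_real (sqrt (1 / 2))"
  have less: "cmod (c * s) < 1" if "cmod c = 1" for c
    using that by (simp add: s_def norm_mult)
  have "rot a = rot (a * s) \<circ> (rot (- cnj a * s) \<circ> rot 0)"
    using rot_unit_circle[OF True s_def] by auto
  then have "distr gauss2 gauss2 (rot a) =
      distr (distr (distr gauss2 gauss2 (rot 0)) gauss2 (rot (- cnj a * s))) gauss2 (rot (a * s))"
    by (simp add: distr_distr comp_assoc)
  also have "\<dots> = gauss2"
    using True less[of a] less[of "- cnj a"] by (simp add: distr_gauss2_rot_less)
  finally show ?thesis .
qed (use assms in \<open>simp add: distr_gauss2_rot_less\<close>)

lemma distr_gauss2_mix:
  assumes "cmod a \<le> 1"
  shows "distr gauss2 gauss (mix a) = gauss"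
proof -
  have "distr gauss2 gauss (fst \<circ> rot a) = distr (distr gauss2 gauss2 (rot a)) gauss fst"
    by (rule distr_distr[symmetric]) measurable
  also have "\<dots> = gauss"
    by (simp add: distr_gauss2_rot[OF assms] gauss.distr_pair_fst)
  also have "fst \<circ> rot a = mix a"
    by (auto simp: rot_def)
  finally show ?thesis .
qed

lemma
  fixes f :: "complex \<Rightarrow> 'b::{banach, second_countable_topology}"
  assumes "cmod a \<le> 1" and [measurable]: "f \<in> borel_measurable borel"
  shows integral_mix: "(\<integral>p. f (mix a p) \<partial>gauss2) = integral\<^sup>L gauss f"
    and integrable_mix: "integrable gauss f \<Longrightarrow> integrable gauss2 (\<lambda>p. f (mix a p))"
proof -
  show "(\<integral>p. f (mix a p) \<partial>gauss2) = integral\<^sup>L gauss f"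
    by (subst (3) distr_gauss2_mix[OF assms(1), symmetric], subst integral_distr) measurable
  show "integrable gauss2 (\<lambda>p. f (mix a p))" if "integrable gauss f"
    using that
    by (subst (asm) distr_gauss2_mix[OF assms(1), symmetric], subst (asm) integrable_distr_eq)
       measurable
qed

section \<open>Mehler operators\<close>

definition mehler :: "complex \<Rightarrow> (complex \<Rightarrow> complex) \<Rightarrow> complex \<Rightarrow> complex" where
  "mehler a f x = (\<integral>y. f (mix a (x, y)) \<partial>gauss)"

definition mehler_l2 :: "complex \<Rightarrow> l2 \<Rightarrow> l2" where
  "mehler_l2 a x = cls (mehler a (rep_l2 x))"

lemma mehler_measurable [measurable]:
  assumes [measurable]: "f \<in> borel_measurable borel"
  shows "mehler a f \<in> borel_measurable borel"
  unfolding mehler_def[abs_def] by measurable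

lemma mehler_1: "mehler 1 f = f"
  using gauss.prob_space by (simp add: fun_eq_iff mehler_def)

lemma mehler_mult: "mehler a (\<lambda>x. c * f x) = (\<lambda>x. c * mehler a f x)"
  by (simp add: fun_eq_iff mehler_def)

lemma square_integrable_mix:
  assumes a: "cmod a \<le> 1" and f: "L2 f"
  shows "square_integrable gauss2 (\<lambda>p. f (mix a p))"
proof -
  note [measurable] = L2_measurable[OF f]
  have "integrable gauss2 (\<lambda>p. (cmod (f (mix a p)))\<^sup>2)"
    by (rule integrable_mix[OF a]) (use L2_norm_square[OF f] in auto)
  then show ?thesis
    by (simp add: square_integrable_def)
qed

lemma AE_L2_mix:
  assumes a: "cmod a \<le> 1" and f: "L2 f"
  shows "AE x in gauss. L2 (\<lambda>y. f (mix a (x, y)))"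
proof -
  note [measurable] = L2_measurable[OF f]
  have "integrable gauss2 (\<lambda>p. (cmod (f (mix a p)))\<^sup>2)"
    by (intro square_integrable_norm_square square_integrable_mix a f)
  from gauss2.AE_integrable_fst'[OF this] show ?thesis
    by eventually_elim (simp add: L2_def)
qed

lemma
  assumes a: "cmod a \<le> 1" and f: "L2 f"
  shows L2_mehler: "L2 (mehler a f)"
    and L2norm_mehler_le: "L2norm (mehler a f) \<le> L2norm f"
proof -
  note [measurable] = L2_measurable[OF f]
  define G where "G x = mean_square gauss (\<lambda>y. f (mix a (x, y)))" for x
  note integrable = square_integrable_norm_square[OF square_integrable_mix[OF a f]]
  have G: "integrable gauss G"
    using gauss2.integrable_fst'[OF integrable] by (simp add: G_def[abs_def] mean_square_def)
  have le: "AE x in gauss. (cmod (mehler a f x))\<^sup>2 \<le> G x"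
    using AE_L2_mix[OF a f]
  proof eventually_elim
    case (elim x)
    have "(cmod (mehler a f x))\<^sup>2 \<le> (\<integral>y. cmod (f (mix a (x, y))) \<partial>gauss)\<^sup>2"
      unfolding mehler_def by (intro power_mono integral_norm_bound) simp
    also have "\<dots> \<le> G x"
      using gauss.integral_norm_square_le[of "\<lambda>y. f (mix a (x, y))"] elim
      by (simp add: L2_eq G_def gauss.prob_space del: gauss.space_eq_UNIV)
    finally show ?case .
  qed
  show L2: "L2 (mehler a f)"
    unfolding L2_eq by (rule square_integrable_bound[OF _ G le]) measurable
  have "mean_square gauss (mehler a f) \<le> (\<integral>x. G x \<partial>gauss)"
    unfolding mean_square_def by (rule integral_mono_AE[OF L2_norm_square[OF L2] G le])
  also have "\<dots> = mean_square gauss f"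
    using gauss2.integral_fst'[OF integrable] integral_mix[OF a, of "\<lambda>x. (cmod (f x))\<^sup>2"]
    by (simp add: G_def mean_square_def)
  finally show "L2norm (mehler a f) \<le> L2norm f"
    by (simp add: L2norm_eq)
qed

lemma cls_mehler_add:
  assumes a: "cmod a \<le> 1" and f: "L2 f" and g: "L2 g"
  shows "cls (mehler a (\<lambda>x. f x + g x)) = cls (mehler a f) + cls (mehler a g)"
proof -
  have "AE x in gauss. mehler a (\<lambda>x. f x + g x) x = mehler a f x + mehler a g x"
    using AE_L2_mix[OF a f] AE_L2_mix[OF a g]
    by eventually_elim (simp add: mehler_def L2_integrable)
  then show ?thesis
    using assms by (simp add: cls_eq_iff L2_mehler L2_add flip: cls_add)
qed

lemma mehler_l2_cls:
  assumes a: "cmod a \<le> 1" and f: "L2 f"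
  shows "mehler_l2 a (cls f) = cls (mehler a f)"
proof -
  define g where "g = rep_l2 (cls f)"
  have g: "L2 g" "cls g = cls f"
    by (simp_all add: g_def L2_rep_l2 cls_rep_l2)
  have d: "L2 (\<lambda>x. g x - f x)"
    using g f by (intro L2_diff)
  have "norm (cls (mehler a (\<lambda>x. g x - f x))) \<le> norm (cls (\<lambda>x. g x - f x))"
    using L2norm_mehler_le[OF a d] by (simp add: norm_cls L2_mehler a d)
  then have "cls (mehler a (\<lambda>x. g x - f x)) = 0"
    using g f by (simp add: cls_diff)
  then show ?thesis
    using cls_mehler_add[OF a d f] by (simp add: mehler_l2_def g_def)
qed

lemma linear_mehler_l2:
  assumes a: "cmod a \<le> 1"
  shows "linear (mehler_l2 a)"
proof (rule linearI)
  fix x y :: l2 and r :: real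
  show "mehler_l2 a (x + y) = mehler_l2 a x + mehler_l2 a y"
    by (cases x, cases y) (simp add: mehler_l2_cls a L2_add cls_mehler_add flip: cls_add)
  have "mehler a (\<lambda>x. r *\<^sub>R f x) = (\<lambda>x. r *\<^sub>R mehler a f x)" for f
    using mehler_mult[of a "of_real r" f] by (simp add: scaleR_conv_of_real)
  then show "mehler_l2 a (r *\<^sub>R x) = r *\<^sub>R mehler_l2 a x"
    by (cases x) (simp add: mehler_l2_cls a L2_scaleR L2_mehler flip: cls_scaleR)
qed

lemma mehler_l2_imul: "cmod a \<le> 1 \<Longrightarrow> mehler_l2 a (imul x) = imul (mehler_l2 a x)"
  by (cases x) (simp add: imul_cls mehler_l2_cls L2_mult L2_mehler mehler_mult)

lemma norm_mehler_l2_le: "cmod a \<le> 1 \<Longrightarrow> norm (mehler_l2 a x) \<le> norm x"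
  by (cases x) (simp add: mehler_l2_cls norm_cls L2_mehler L2norm_mehler_le)

lemma mehler_l2_1: "mehler_l2 1 x = x"
  by (cases x) (simp add: mehler_l2_cls mehler_1)

text \<open>The map \<open>rot a\<close> exchanges \<open>fst\<close> with \<open>mix a\<close>, which turns \<open>a\<close> into \<open>cnj a\<close>.\<close>
lemma mehler_adjoint:
  assumes a: "cmod a \<le> 1" and f: "L2 f" and g: "L2 g"
  shows "L2inner (mehler a f) g = L2inner f (mehler (cnj a) g)"
proof -
  define h where "h p = f (mix a p) * cnj (g (mix 1 p))" for p
  define H where "H p = f (mix 1 p) * cnj (g (mix (cnj a) p))" for p
  have h: "integrable gauss2 h" and H: "integrable gauss2 H"
    unfolding h_def[abs_def] H_def[abs_def]
    using a by (intro integrable_mult_cnj square_integrable_mix f g; simp)+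
  have hH: "h p = H (rot a p)" for p
    unfolding h_def H_def mix_cnj_rot[OF a] by (simp add: rot_def)
  have "L2inner (mehler a f) g = (\<integral>x. \<integral>y. h (x, y) \<partial>gauss \<partial>gauss)"
    by (simp add: L2inner_def mehler_def h_def)
  also have "\<dots> = (\<integral>p. h p \<partial>gauss2)"
    by (rule gauss2.integral_fst'[OF h])
  also have "\<dots> = (\<integral>p. H p \<partial>gauss2)"
    using integral_distr[of "rot a" gauss2 gauss2 H] H by (simp add: hH distr_gauss2_rot[OF a])
  also have "\<dots> = (\<integral>x. \<integral>y. H (x, y) \<partial>gauss \<partial>gauss)"
    by (rule gauss2.integral_fst'[OF H, symmetric])
  also have "\<dots> = L2inner f (mehler (cnj a) g)"
    by (simp add: L2inner_def mehler_def H_def)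
  finally show ?thesis .
qed

lemma mehler_l2_adjoint: "cmod a \<le> 1 \<Longrightarrow> inner (mehler_l2 a x) y = inner x (mehler_l2 (cnj a) y)"
  by (cases x, cases y) (simp add: mehler_l2_cls inner_cls L2_mehler mehler_adjoint)

text \<open>The sum of the independent Gaussians \<open>b * noise a * y\<close> and \<open>noise b * z\<close> is distributed as
  \<open>noise (a * b)\<close> times a single one.\<close>
lemma mix_mix:
  assumes a: "cmod a \<le> 1" and b: "cmod b \<le> 1"
  obtains c where "cmod c \<le> 1" "\<And>x y z. mix b (mix a (x, y), z) = mix (a * b) (x, mix c (y, z))"
proof -
  let ?s = "noise (a * b)"
  have ab: "cmod (a * b) \<le> 1"
    using a b by (rule cmod_mult_le_1)
  have square: "(cmod b * noise a)\<^sup>2 = ?s\<^sup>2 - (noise b)\<^sup>2"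
    using a b ab by (simp add: noise_square norm_mult power_mult_distrib algebra_simps)
  show thesis
  proof (cases "?s = 0")
    case True
    with square have "(noise b)\<^sup>2 + (cmod b * noise a)\<^sup>2 = 0"
      by simp
    then have "noise b = 0" "b * of_real (noise a) = 0"
      by auto
    with True show thesis
      by (intro that[of 0]) (simp_all add: mix_def algebra_simps)
  next
    case False
    define c where "c = b * of_real (noise a / ?s)"
    have "(cmod c)\<^sup>2 = (cmod b * noise a)\<^sup>2 / ?s\<^sup>2"
      by (simp add: c_def norm_mult norm_divide power_mult_distrib power_divide)
    with False have c: "1 - (cmod c)\<^sup>2 = (noise b / ?s)\<^sup>2"
      unfolding square by (simp add: power_divide field_simps)
    then have "cmod c \<le> 1"
      by (metis abs_norm_cancel abs_square_le_1 diff_ge_0_iff_ge zero_le_power2)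
    moreover have "noise c = noise b / ?s"
      using a b ab unfolding noise_def[of c] c by (simp add: noise_def abs_square_le_1)
    then have "of_real (noise b) = complex_of_real ?s * of_real (noise c)"
      using False by simp
    moreover have "b * of_real (noise a) = of_real ?s * c"
      using False by (simp add: c_def)
    ultimately show thesis
      by (intro that[of c]) (simp_all add: mix_def algebra_simps)
  qed
qed

lemma mehler_mehler:
  assumes a: "cmod a \<le> 1" and b: "cmod b \<le> 1" and [measurable]: "f \<in> borel_measurable borel"
    and integrable: "integrable gauss (\<lambda>w. f (mix (a * b) (x, w)))"
  shows "mehler a (mehler b f) x = mehler (a * b) f x"
proof -
  obtain c where c: "cmod c \<le> 1" "\<And>x y z. mix b (mix a (x, y), z) = mix (a * b) (x, mix c (y, z))"
    using mix_mix[OF a b] by blast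
  have "mehler a (mehler b f) x = (\<integral>y. \<integral>z. f (mix (a * b) (x, mix c (y, z))) \<partial>gauss \<partial>gauss)"
    by (simp add: mehler_def c(2))
  also have "\<dots> = (\<integral>p. f (mix (a * b) (x, mix c p)) \<partial>gauss2)"
    by (rule gauss2.integral_fst'[OF integrable_mix[OF c(1) _ integrable]]) measurable
  also have "\<dots> = mehler (a * b) f x"
    unfolding mehler_def by (rule integral_mix[OF c(1)]) measurable
  finally show ?thesis .
qed

lemma mehler_l2_mehler_l2:
  assumes a: "cmod a \<le> 1" and b: "cmod b \<le> 1"
  shows "mehler_l2 a (mehler_l2 b x) = mehler_l2 (a * b) x"
proof -
  have ab: "cmod (a * b) \<le> 1"
    using a b by (rule cmod_mult_le_1)
  obtain f where f: "x = cls f" and L2: "L2 f" by (cases x)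
  note [measurable] = L2_measurable[OF L2]
  have "AE x in gauss. mehler a (mehler b f) x = mehler (a * b) f x"
    using AE_L2_mix[OF ab L2]
    by eventually_elim (intro mehler_mehler a b L2_integrable; measurable)
  then show ?thesis
    by (simp add: f L2 mehler_l2_cls a b ab L2_mehler cls_eq_iff)
qed

lemma mehler_tendsto:
  assumes lim: "u \<longlonglongrightarrow> a" and \<phi>: "Cb \<phi>"
  shows "(\<lambda>n. mehler (u n) \<phi> x) \<longlonglongrightarrow> mehler a \<phi> x"
proof -
  obtain B where B: "\<And>x. cmod (\<phi> x) \<le> B"
    using \<phi> unfolding Cb_eq by (rule bounded_continuous_bound) blast
  have [measurable]: "\<phi> \<in> borel_measurable borel"
    using \<phi> unfolding Cb_eq by (rule bounded_continuous_measurable)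
  show ?thesis
    unfolding mehler_def
  proof (rule integral_dominated_convergence[where w = "\<lambda>_. B"])
    have "(\<lambda>n. mix (u n) (x, y)) \<longlonglongrightarrow> mix a (x, y)" for y
      unfolding mix_def noise_def by (intro tendsto_intros lim)
    moreover have "isCont \<phi> z" for z
      using \<phi> by (auto simp: Cb_def continuous_on_eq_continuous_at)
    ultimately show "AE y in gauss. (\<lambda>n. \<phi> (mix (u n) (x, y))) \<longlonglongrightarrow> \<phi> (mix a (x, y))"
      by (intro AE_I2 isCont_tendsto_compose[where g = \<phi>])
  qed (auto simp: B)
qed

lemma mehler_l2_tendsto_Cb:
  assumes u: "\<And>n. cmod (u n) \<le> 1" "u \<longlonglongrightarrow> a" and a: "cmod a \<le> 1" and \<phi>: "Cb \<phi>"
  shows "(\<lambda>n. mehler_l2 (u n) (cls \<phi>)) \<longlonglongrightarrow> mehler_l2 a (cls \<phi>)"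
proof -
  obtain B where B: "\<And>x. cmod (\<phi> x) \<le> B"
    using \<phi> unfolding Cb_eq by (rule bounded_continuous_bound) blast
  have [measurable]: "\<phi> \<in> borel_measurable borel"
    using \<phi> unfolding Cb_eq by (rule bounded_continuous_measurable)
  have "(\<lambda>n. mean_square gauss (\<lambda>x. mehler (u n) \<phi> x - mehler a \<phi> x)) \<longlonglongrightarrow> 0"
  proof (rule tendsto_mean_square_dominated)
    show "cmod (mehler (u n) \<phi> x) \<le> B" for n x
    proof -
      have "cmod (mehler (u n) \<phi> x) \<le> (\<integral>y. cmod (\<phi> (mix (u n) (x, y))) \<partial>gauss)"
        unfolding mehler_def by (rule integral_norm_bound)
      also have "\<dots> \<le> B"
        by (rule gauss.integral_le_const) (auto simp: B intro!: gauss.integrable_const_bound[of _ B])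
      finally show ?thesis .
    qed
  qed (auto intro: mehler_tendsto[OF u(2) \<phi>] mehler_measurable)
  from tendsto_real_sqrt[OF this] show ?thesis
    by (simp add: mehler_l2_cls u a \<phi> Cb_imp_L2 tendsto_cls_iff L2_mehler L2norm_eq)
qed

lemma mehler_l2_strongly_continuous: "continuous_on {a. cmod a \<le> 1} (\<lambda>a. mehler_l2 a x)"
  unfolding continuous_on_sequentially o_def
proof (intro allI ballI impI, elim conjE)
  fix u a assume u: "\<forall>n. u n \<in> {a. cmod a \<le> 1}" "u \<longlonglongrightarrow> a" and a: "a \<in> {a. cmod a \<le> 1}"
  have nonexpansive: "dist (mehler_l2 b x) (mehler_l2 b y) \<le> dist x y" if "cmod b \<le> 1" for b x y
    using norm_mehler_l2_le[OF that, of "x - y"]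
    by (simp add: dist_norm linear_diff[OF linear_mehler_l2[OF that]])
  show "(\<lambda>n. mehler_l2 (u n) x) \<longlonglongrightarrow> mehler_l2 a x"
    by (rule tendsto_nonexpansive_if_dense[OF cls_Cb_dense])
       (use u a in \<open>auto intro: nonexpansive mehler_l2_tendsto_Cb\<close>)
qed

section \<open>Operators on functions and on their classes\<close>

locale l2_operator =
  fixes D :: "(complex \<Rightarrow> complex) set" and N :: "(complex \<Rightarrow> complex) \<Rightarrow> complex \<Rightarrow> complex"
    and E :: "l2 set" and A :: "l2 \<Rightarrow> l2"
  assumes dom_iff: "f \<in> D \<longleftrightarrow> L2 f \<and> cls f \<in> E"
    and L2_ran: "f \<in> D \<Longrightarrow> L2 (N f)"
    and cls_N: "f \<in> D \<Longrightarrow> cls (N f) = A (cls f)"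
    and imul_dom: "x \<in> E \<Longrightarrow> imul x \<in> E"
    and A_imul: "x \<in> E \<Longrightarrow> A (imul x) = imul (A x)"
begin

text \<open>A real adjoint identity on a domain that is closed under \<open>imul\<close> is a complex one.\<close>
lemma adjoint_maps_iff:
  assumes g: "L2 g" and h: "L2 h"
  shows "adjoint_maps E A (cls g) (cls h) \<longleftrightarrow> (\<forall>f\<in>D. L2inner (N f) g = L2inner f h)"
proof
  assume adj: "adjoint_maps E A (cls g) (cls h)"
  show "\<forall>f\<in>D. L2inner (N f) g = L2inner f h"
  proof
    fix f assume f: "f \<in> D"
    then have L2: "L2 f" and dom: "cls f \<in> E" by (simp_all add: dom_iff)
    have "inner (A (cls f)) (cls g) = inner (cls f) (cls h)"
      using adj dom unfolding adjoint_maps_def by blast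
    moreover have "inner (imul (A (cls f))) (cls g) = inner (imul (cls f)) (cls h)"
      using adj imul_dom[OF dom] A_imul[OF dom] unfolding adjoint_maps_def by metis
    ultimately show "L2inner (N f) g = L2inner f h"
      using f L2 g h by (simp add: L2inner_eq_iff L2_ran cls_N)
  qed
next
  assume adj: "\<forall>f\<in>D. L2inner (N f) g = L2inner f h"
  show "adjoint_maps E A (cls g) (cls h)"
    unfolding adjoint_maps_def
  proof
    fix x assume "x \<in> E"
    moreover obtain f where f: "x = cls f" "L2 f" by (cases x)
    ultimately have D: "f \<in> D" by (simp add: dom_iff)
    with adj have "L2inner (N f) g = L2inner f h" by blast
    then show "inner (A x) (cls g) = inner x (cls h)"
      using f g h L2_ran[OF D] cls_N[OF D] by (simp add: L2inner_eq_iff)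
  qed
qed

lemma adj_dom_iff: "g \<in> adj_dom D N \<longleftrightarrow> L2 g \<and> (\<exists>k. adjoint_maps E A (cls g) k)"
  by (auto simp: adj_dom_def ex_L2_cls_iff simp flip: adjoint_maps_iff cong: conj_cong)

lemma
  assumes "g \<in> adj_dom D N"
  shows L2_adj: "L2 (adj D N g)"
    and adjoint_maps_adj: "adjoint_maps E A (cls g) (cls (adj D N g))"
proof -
  have g: "L2 g" "\<exists>h. L2 h \<and> (\<forall>f\<in>D. L2inner (N f) g = L2inner f h)"
    using assms by (simp_all add: adj_dom_def)
  from someI_ex[OF g(2)] show "L2 (adj D N g)" "adjoint_maps E A (cls g) (cls (adj D N g))"
    unfolding adj_def[symmetric] by (simp_all add: adjoint_maps_iff g(1))
qed

lemma closed_graph_limit: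
  assumes closed: "closed {(x, y). x \<in> E \<and> A x = y}"
    and fs: "\<And>n. fs n \<in> D" and f: "L2 f" and h: "L2 h"
    and "(\<lambda>n. L2norm (\<lambda>x. fs n x - f x)) \<longlonglongrightarrow> 0" "(\<lambda>n. L2norm (\<lambda>x. N (fs n) x - h x)) \<longlonglongrightarrow> 0"
  shows "f \<in> D" "L2norm (\<lambda>x. N f x - h x) = 0"
proof -
  have fs_L2: "L2 (fs n)" "L2 (N (fs n))" for n
    using fs by (auto simp: dom_iff intro: L2_ran)
  have "(\<lambda>n. cls (fs n)) \<longlonglongrightarrow> cls f" "(\<lambda>n. cls (N (fs n))) \<longlonglongrightarrow> cls h"
    using assms fs_L2 by (simp_all add: tendsto_cls_iff)
  then have tendsto: "(\<lambda>n. (cls (fs n), cls (N (fs n)))) \<longlonglongrightarrow> (cls f, cls h)"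
    by (rule tendsto_Pair)
  have "(cls (fs n), cls (N (fs n))) \<in> {(x, y). x \<in> E \<and> A x = y}" for n
    using fs by (auto simp: dom_iff cls_N)
  then have "(cls f, cls h) \<in> {(x, y). x \<in> E \<and> A x = y}"
    using tendsto by (rule closed_sequentially[OF closed])
  then show "f \<in> D" "L2norm (\<lambda>x. N f x - h x) = 0"
    using f h cls_N[of f] L2_ran[of f] by (auto simp: dom_iff simp flip: norm_cls_diff)
qed

lemma normal_op_if_normal_operator:
  assumes "normal_operator E A"
  shows "normal_op D N"
  unfolding normal_op_def
proof (intro conjI allI impI ballI)
  have dense: "closure E = UNIV" and closed: "closed {(x, y). x \<in> E \<and> A x = y}"
    and dom_adjoint: "\<And>y. y \<in> E \<longleftrightarrow> (\<exists>k. adjoint_maps E A y k)"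
    and norm_adjoint: "\<And>y k. y \<in> E \<Longrightarrow> adjoint_maps E A y k \<Longrightarrow> norm k = norm (A y)"
    using assms unfolding normal_operator_def by blast+
  show "D \<subseteq> {f. L2 f}" by (auto simp: dom_iff)
  show "L2 (N f)" if "f \<in> D" for f using that by (rule L2_ran)
  show "\<exists>g\<in>D. L2norm (\<lambda>x. f x - g x) < e" if f: "L2 f" and "e > 0" for f e
  proof -
    obtain y where y: "y \<in> E" "dist y (cls f) < e"
      using dense \<open>e > 0\<close> by (metis UNIV_I closure_approachable)
    obtain g where "y = cls g" "L2 g" by (cases y)
    with y f show ?thesis
      by (auto simp: dom_iff dist_norm norm_minus_commute simp flip: norm_cls_diff intro!: bexI[of _ g])
  qed
  show adj_dom: "adj_dom D N = D"
    by (simp add: set_eq_iff adj_dom_iff dom_iff dom_adjoint)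
  show "L2norm (N g) = L2norm (adj D N g)" if g: "g \<in> D" for g
  proof -
    have "g \<in> adj_dom D N" using g by (simp add: adj_dom)
    then have "norm (cls (adj D N g)) = norm (A (cls g))"
      using g by (intro norm_adjoint adjoint_maps_adj) (simp_all add: dom_iff)
    then show ?thesis
      using L2_adj[OF \<open>g \<in> adj_dom D N\<close>] L2_ran[OF g] cls_N[OF g] by (simp flip: norm_cls)
  qed
  fix fs f h
  assume "(\<forall>n. fs n \<in> D) \<and> L2 f \<and> L2 h \<and>
      (\<lambda>n. L2norm (\<lambda>x. fs n x - f x)) \<longlonglongrightarrow> 0 \<and> (\<lambda>n. L2norm (\<lambda>x. N (fs n) x - h x)) \<longlonglongrightarrow> 0"
  with closed show "f \<in> D" "L2norm (\<lambda>x. N f x - h x) = 0"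
    by (auto dest: closed_graph_limit)
qed

end

section \<open>The semigroup and its generator\<close>

definition drift :: "real \<Rightarrow> real \<Rightarrow> complex" where
  "drift \<theta> t = exp (- cis \<theta> * complex_of_real t)"

abbreviation mehler_semigroup :: "real \<Rightarrow> real \<Rightarrow> l2 \<Rightarrow> l2" where
  "mehler_semigroup \<theta> t \<equiv> mehler_l2 (drift \<theta> t)"

lemma cmod_drift: "cmod (drift \<theta> t) = exp (- t * cos \<theta>)"
  by (simp add: drift_def mult.commute)

lemma cmod_drift_le_1: "cos \<theta> > 0 \<Longrightarrow> t \<ge> 0 \<Longrightarrow> cmod (drift \<theta> t) \<le> 1"
  by (simp add: cmod_drift)

lemma drift_0: "drift \<theta> 0 = 1"
  by (simp add: drift_def)

lemma drift_add: "drift \<theta> (s + t) = drift \<theta> s * drift \<theta> t"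
  by (simp add: drift_def exp_add[symmetric] algebra_simps)

lemma cnj_drift: "cnj (drift \<theta> t) = drift (- \<theta>) t"
  by (simp add: drift_def exp_cnj cis_cnj)

lemma Pt_eq_mehler: "Pt \<theta> t = mehler (drift \<theta> t)"
proof -
  have "(cmod (drift \<theta> t))\<^sup>2 = exp (- 2 * t * cos \<theta>)"
    by (simp add: cmod_drift power2_eq_square exp_add[symmetric])
  then show ?thesis
    by (intro ext) (simp add: Pt_def mehler_def mix_def noise_def drift_def)
qed

lemma contraction_semigroup_mehler:
  assumes "cos \<theta> > 0"
  shows "contraction_semigroup (mehler_semigroup \<theta>)"
proof (rule contraction_semigroup.intro)
  show "continuous_on {0..} (\<lambda>t. mehler_semigroup \<theta> t x)" for x
  proof (rule continuous_on_compose2[OF mehler_l2_strongly_continuous])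
    show "continuous_on {0..} (drift \<theta>)"
      unfolding drift_def[abs_def] by (intro continuous_intros)
  qed (auto intro: cmod_drift_le_1 assms)
qed (simp_all add: linear_mehler_l2 norm_mehler_l2_le mehler_l2_1 mehler_l2_mehler_l2 drift_0 drift_add
      cmod_drift_le_1 assms)

lemma normal_semigroup_mehler:
  assumes "cos \<theta> > 0"
  shows "normal_semigroup (mehler_semigroup \<theta>) (mehler_semigroup (- \<theta>))"
proof -
  interpret contraction_semigroup "mehler_semigroup \<theta>"
    using assms by (rule contraction_semigroup_mehler)
  interpret adjoint: contraction_semigroup "mehler_semigroup (- \<theta>)"
    using assms by (intro contraction_semigroup_mehler) simp
  show ?thesis
    using assms
    by unfold_locales
       (simp_all add: mehler_l2_adjoint mehler_l2_mehler_l2 cmod_drift_le_1 cnj_drift mult.commute)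
qed

context
  fixes \<theta> :: real
  assumes cos: "cos \<theta> > 0"
begin

interpretation normal_semigroup "mehler_semigroup \<theta>" "mehler_semigroup (- \<theta>)"
  using cos by (rule normal_semigroup_mehler)

lemma Trel_iff:
  assumes t: "t \<ge> 0" and f: "L2 f" and g: "L2 g"
  shows "Trel \<theta> t f g \<longleftrightarrow> cls g = mehler_semigroup \<theta> t (cls f)"
proof -
  let ?T = "mehler_semigroup \<theta> t"
  note tendsto_T = bounded_linear.tendsto[OF T.bounded_linear[OF t]]
  have "Trel \<theta> t f g \<longleftrightarrow>
      (\<exists>\<phi>. (\<forall>n. Cb (\<phi> n)) \<and> (\<lambda>n. cls (\<phi> n)) \<longlonglongrightarrow> cls f \<and> (\<lambda>n. ?T (cls (\<phi> n))) \<longlonglongrightarrow> cls g)"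
    unfolding Trel_def Pt_eq_mehler
    by (intro ex_cong1 conj_cong refl)
       (simp_all add: tendsto_cls_iff mehler_l2_cls cmod_drift_le_1 cos t Cb_imp_L2 L2_mehler f g)
  also have "\<dots> \<longleftrightarrow> cls g = ?T (cls f)"
  proof
    assume "\<exists>\<phi>. (\<forall>n. Cb (\<phi> n)) \<and> (\<lambda>n. cls (\<phi> n)) \<longlonglongrightarrow> cls f \<and> (\<lambda>n. ?T (cls (\<phi> n))) \<longlonglongrightarrow> cls g"
    then show "cls g = ?T (cls f)"
      using tendsto_T LIMSEQ_unique by blast
  next
    assume eq: "cls g = ?T (cls f)"
    have "cls f \<in> closure (cls ` Collect Cb)"
      by (simp add: cls_Cb_dense)
    then obtain X where X: "\<And>n. X n \<in> cls ` Collect Cb" "X \<longlonglongrightarrow> cls f"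
      unfolding closure_sequential by blast
    from X(1) have "\<forall>n. \<exists>\<phi>. Cb \<phi> \<and> X n = cls \<phi>"
      by blast
    then obtain \<phi> where \<phi>: "\<And>n. Cb (\<phi> n)" "X = (\<lambda>n. cls (\<phi> n))"
      by metis
    with X(2) tendsto_T[OF X(2)]
    show "\<exists>\<phi>. (\<forall>n. Cb (\<phi> n)) \<and> (\<lambda>n. cls (\<phi> n)) \<longlonglongrightarrow> cls f \<and> (\<lambda>n. ?T (cls (\<phi> n))) \<longlonglongrightarrow> cls g"
      unfolding eq by blast
  qed
  finally show ?thesis .
qed

lemma
  assumes t: "t \<ge> 0" and f: "L2 f"
  shows L2_T2: "L2 (T2 \<theta> t f)"
    and cls_T2: "cls (T2 \<theta> t f) = mehler_semigroup \<theta> t (cls f)"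
proof -
  have T2: "T2 \<theta> t f = (SOME g. L2 g \<and> cls g = mehler_semigroup \<theta> t (cls f))"
    by (simp add: T2_def Trel_iff t f cong: conj_cong)
  have "\<exists>g. L2 g \<and> cls g = mehler_semigroup \<theta> t (cls f)"
    by (metis cls_rep_l2 L2_rep_l2)
  from someI_ex[OF this] show "L2 (T2 \<theta> t f)" "cls (T2 \<theta> t f) = mehler_semigroup \<theta> t (cls f)"
    by (simp_all add: T2)
qed

lemma l2_operator_T2:
  assumes "t \<ge> 0"
  shows "l2_operator {f. L2 f} (T2 \<theta> t) UNIV (mehler_semigroup \<theta> t)"
  using assms by unfold_locales (simp_all add: L2_T2 cls_T2 mehler_l2_imul cmod_drift_le_1 cos)

lemma gen_lim_iff:
  assumes f: "L2 f"
  shows "gen_lim \<theta> f h \<longleftrightarrow> L2 h \<and> T.generator_maps (cls f) (cls h)"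
proof -
  let ?q = "\<lambda>s x. (T2 \<theta> s f x - f x) / complex_of_real s"
  have q_scaleR: "?q s = (\<lambda>x. inverse s *\<^sub>R (T2 \<theta> s f x - f x))" for s
    by (simp add: fun_eq_iff scaleR_conv_of_real divide_inverse mult.commute)
  have q: "L2 (?q s)" "cls (?q s) = (mehler_semigroup \<theta> s (cls f) - cls f) /\<^sub>R s" if "s > 0" for s
    using that f
    by (simp_all add: q_scaleR cls_scaleR cls_diff cls_T2 L2_T2 L2_scaleR L2_diff)
  have "((\<lambda>s. L2norm (\<lambda>x. ?q s x - h x)) \<longlongrightarrow> 0) (at_right 0) \<longleftrightarrow> T.generator_maps (cls f) (cls h)"
    if h: "L2 h"
  proof -
    have "\<forall>\<^sub>F s in at_right 0. L2 (?q s)"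
      using eventually_at_right_less[of "0::real"] by eventually_elim (rule q)
    from tendsto_cls_iff[OF this h]
    have "((\<lambda>s. L2norm (\<lambda>x. ?q s x - h x)) \<longlongrightarrow> 0) (at_right 0) \<longleftrightarrow>
        ((\<lambda>s. cls (?q s)) \<longlongrightarrow> cls h) (at_right 0)" ..
    also have "\<dots> \<longleftrightarrow> T.generator_maps (cls f) (cls h)"
      unfolding T.generator_maps_iff_tendsto
      using eventually_at_right_less[of "0::real"]
      by (intro filterlim_cong refl) (auto elim: eventually_mono simp: q)
    finally show ?thesis .
  qed
  then show ?thesis
    by (auto simp: gen_lim_def)
qed

lemma l2_operator_gen: "l2_operator (gen_dom \<theta>) (gen \<theta>) T.generator_dom T.generator"
proof
  show "f \<in> gen_dom \<theta> \<longleftrightarrow> L2 f \<and> cls f \<in> T.generator_dom" for f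
  proof (cases "L2 f")
    case True
    then have "(\<exists>h. gen_lim \<theta> f h) \<longleftrightarrow> (\<exists>k. T.generator_maps (cls f) k)"
      using gen_lim_iff ex_L2_cls_iff[of "T.generator_maps (cls f)"] by blast
    with True show ?thesis
      by (simp add: gen_dom_def T.generator_dom_def)
  qed (simp add: gen_dom_def)
  fix f assume "f \<in> gen_dom \<theta>"
  then have "L2 f" "\<exists>h. gen_lim \<theta> f h" by (simp_all add: gen_dom_def)
  from someI_ex[OF this(2)] \<open>L2 f\<close> show "L2 (gen \<theta> f)" "cls (gen \<theta> f) = T.generator (cls f)"
    unfolding gen_def[symmetric] by (simp_all add: gen_lim_iff T.generator_maps_iff)
next
  fix x assume "x \<in> T.generator_dom"
  then have "T.generator_maps x (T.generator x)"
    by (simp add: T.generator_maps_iff)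
  then have "T.generator_maps (imul x) (imul (T.generator x))"
    by (rule T.generator_maps_bounded_linear[OF bounded_linear_imul, rotated])
       (simp add: mehler_l2_imul cmod_drift_le_1[OF cos])
  then show "imul x \<in> T.generator_dom" "T.generator (imul x) = imul (T.generator x)"
    by (simp_all add: T.generator_maps_iff)
qed

lemma normal_op_T2: "t \<ge> 0 \<Longrightarrow> normal_op {f. L2 f} (T2 \<theta> t)"
  by (rule l2_operator.normal_op_if_normal_operator[OF l2_operator_T2 normal_operator_T])

lemma normal_op_gen: "normal_op (gen_dom \<theta>) (gen \<theta>)"
  by (rule l2_operator.normal_op_if_normal_operator[OF l2_operator_gen normal_operator_generator])

end

theorem theorem3p4:
  fixes \<theta> :: real
  assumes "- (pi / 2) < \<theta>" and "\<theta> < pi / 2"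
  shows "(\<forall>t\<ge>0. normal_op {f. L2 f} (T2 \<theta> t)) \<and> normal_op (gen_dom \<theta>) (gen \<theta>)"
proof -
  have "cos \<theta> > 0"
    using assms by (rule cos_gt_zero_pi)
  then show ?thesis
    by (simp add: normal_op_T2 normal_op_gen)
qed

end
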